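(* Let $\mathcal{L}$ be a countable first-order language, let $T$ be an $\mathcal{L}$-theory, and let $\mathcal{G}$ be an $\mathcal{L}$-hypersequent. The following statements are equivalent: (a) $T\models_{[0,1]}\mathcal{G}$. (b) For each positive integer $n$, there exist positive integers $m_1,\dots,m_k$ and formulas $C_1,\dots,C_k\in T$ such that $$\vdash_{\mathrm{G\text{Ł}}\forall}\; m_1C_1\Rightarrow_{\frac1n}\bot\mid\cdots\mid m_kC_k\Rightarrow_{\frac1n}\bot\mid\mathcal{G}_{\frac1n}.$$ (c) $T\vdash_{\mathrm{G\text{Ł}}\forall+\text{(s-Cut)}}\mathcal{G}_{\frac1n}$ for each positive integer $n$.
   Context: **Syntax.** Fix two disjoint infinite sets of variables: free variables ($a,b,c,\dots$) and bound variables ($x,y,z,\dots$). A first-order language $\mathcal{L}$ consists of predicate, function and constant symbols (with arities). $\mathcal{L}$-terms are built from free variables, constants and function symbols; $\mathcal{L}$-semiterms may also use bound variables. $\mathcal{L}$-formulas: $\bot$; atomic formulas $P(t_1,\dots,t_k)$ with $t_i$ $\mathcal{L}$-terms; $A\to B$; and $\forall xA[x/a]$, $\exists xA[x/a]$, where $A$ is an $\mathcal{L}$-formula, $a$ a free variable, $x$ a bound variable not occurring in $A$, and $A[x/a]$ replaces every occurrence of $a$ by $x$. Semiformulas are like formulas except that bound variables may also occur free. For $\forall xA(x)$ or $\exists xA(x)$ and a term $t$, $A(t)$ is the result of replacing the free occurrences of $x$ in $A$ by $t$. A sequent $\Gamma\Rightarrow\Delta$ is an ordered pair of finite multisets of formulas.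 A hypersequent $\mathcal{S}_1\mid\cdots\mid\mathcal{S}_r$ is a finite multiset of sequents. An $\mathcal{L}$-theory is a set of $\mathcal{L}$-formulas. Commas and $\mid$ denote multiset union; $nA$ is the multiset of $n$ copies of $A$; $n\Gamma$ is the $n$-fold multiset union of $\Gamma$. **Affine $[0,1]$-semantics ($0$ is truth, $1$ is falsity).** A $[0,1]$-interpretation $\mathfrak{I}=(\mathcal{M},\beta)$ consists of a structure $\mathcal{M}$ with nonempty universe $M$, with the usual interpretations of constants and function symbols, and with $P^{\mathcal{M}}:M^k\to[0,1]$ for each $k$-ary predicate symbol $P$, together with an assignment $\beta$ of elements of $M$ to all free and bound variables, extended to semiterms as usual. $\mathfrak{I}[x\mapsto m]$ changes the value of $\beta$ at $x$ to $m$. Truth values: $[\![\bot]\!]=1$; $[\![P(t_1,\dots,t_k)]\!]=P^{\mathcal{M}}(\beta(t_1),\dots,\beta(t_k))$; $[\![A\to B]\!]=\max\{[\![B]\!]-[\![A]\!],0\}$; $[\![\forall xA]\!]_{\mathfrak{I}}=\sup_{m\in M}[\![A]\!]_{\mathfrak{I}[x\mapsto m]}$; $[\![\exists xA]\!]_{\mathfrak{I}}=\inf_{m\in M}[\![A]\!]_{\mathfrak{I}[x\mapsto m]}$; $[\![\Gamma]\!]=\sum_{A\in\Gamma}[\![A]\!]$ (with $[\![\varnothing]\!]=0$); $[\![\Gamma\Rightarrow\Delta]\!]=[\![\Delta]\!]-[\![\Gamma]\!]$; $[\![\mathcal{G}]\!]=\inf_{\mathcal{S}\in\mathcal{G}}[\![\mathcal{S}]\!]$.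 A hypersequent $\mathcal{G}$ is true in $\mathfrak{I}$ if $[\![\mathcal{G}]\!]_{\mathfrak{I}}\le 0$. A formula $A$ is identified with the hypersequent $\Rightarrow A$, so $A$ is true iff $[\![A]\!]_{\mathfrak{I}}=0$. $\mathfrak{I}$ is a $[0,1]$-model of $T$ if every formula of $T$ is true in $\mathfrak{I}$. $T\models_{[0,1]}\mathcal{G}$ means that $\mathcal{G}$ is true in every $[0,1]$-model of $T$. **Calculus $\mathrm{GŁ}\forall$** (premises / conclusion; $\mathcal{G}$ is an arbitrary side hypersequent unless stated otherwise). Axioms: $A\Rightarrow A$ (ID); $\Rightarrow$ (the empty sequent, EMP); $\bot\Rightarrow A$ ($\bot$). Structural rules: (EW) $\mathcal{G}$ / $\mathcal{G}\mid\Gamma\Rightarrow\Delta$, with $\mathcal{G}\ne\varnothing$; (EC) $\mathcal{G}\mid\Gamma\Rightarrow\Delta\mid\Gamma\Rightarrow\Delta$ / $\mathcal{G}\mid\Gamma\Rightarrow\Delta$; (IW) $\mathcal{G}\mid\Gamma\Rightarrow\Delta$ / $\mathcal{G}\mid\Gamma,A\Rightarrow\Delta$; (S) $\mathcal{G}\mid\Gamma_1,\Gamma_2\Rightarrow\Delta_1,\Delta_2$ / $\mathcal{G}\mid\Gamma_1\Rightarrow\Delta_1\mid\Gamma_2\Rightarrow\Delta_2$; (M) $\mathcal{G}\mid\Gamma_1\Rightarrow\Delta_1$ and $\mathcal{G}\mid\Gamma_2\Rightarrow\Delta_2$ / $\mathcal{G}\mid\Gamma_1,\Gamma_2\Rightarrow\Delta_1,\Delta_2$.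 Logical rules: ($\to\Rightarrow$) $\mathcal{G}\mid\Gamma\Rightarrow\Delta\mid\Gamma,B\Rightarrow A,\Delta$ / $\mathcal{G}\mid\Gamma,A\to B\Rightarrow\Delta$; ($\Rightarrow\to$) $\mathcal{G}\mid\Gamma\Rightarrow\Delta$ and $\mathcal{G}\mid\Gamma,A\Rightarrow B,\Delta$ / $\mathcal{G}\mid\Gamma\Rightarrow A\to B,\Delta$; ($\forall\Rightarrow$) $\mathcal{G}\mid\Gamma,A(t)\Rightarrow\Delta$ / $\mathcal{G}\mid\Gamma,\forall xA(x)\Rightarrow\Delta$; ($\Rightarrow\forall$) $\mathcal{G}\mid\Gamma\Rightarrow A(a),\Delta$ / $\mathcal{G}\mid\Gamma\Rightarrow\forall xA(x),\Delta$; ($\exists\Rightarrow$) $\mathcal{G}\mid\Gamma,A(a)\Rightarrow\Delta$ / $\mathcal{G}\mid\Gamma,\exists xA(x)\Rightarrow\Delta$; ($\Rightarrow\exists$) $\mathcal{G}\mid\Gamma\Rightarrow A(t),\Delta$ / $\mathcal{G}\mid\Gamma\Rightarrow\exists xA(x),\Delta$. Here $t$ is any $\mathcal{L}$-term, and the eigenvariable $a$ in ($\Rightarrow\forall$), ($\exists\Rightarrow$) is a free variable not occurring in the conclusion. **Sequent-level cut.** (s-Cut): $\mathcal{G}\mid\Gamma\Rightarrow\Delta$ and $\mathcal{G}\mid\Delta\Rightarrow\Gamma,\bot$ / $\mathcal{G}$, provided $\mathcal{G}\neq\varnothing$. $\mathrm{GŁ}\forall+\text{(s-Cut)}$ is $\mathrm{GŁ}\forall$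 with this rule added. **Derivability.** For a calculus $\mathrm{S}$ containing $\mathrm{GŁ}\forall$, $\vdash_{\mathrm{S}}\mathcal{G}$ means that $\mathcal{G}$ is the root of a finite derivation tree of $\mathcal{L}$-hypersequents whose leaves are axioms and whose other nodes are obtained by the rules of $\mathrm{S}$. $T\vdash_{\mathrm{S}}\mathcal{G}$ means that there is such a tree in which, additionally, each sequent $\Rightarrow C$ with $C\in T$ may be used as an axiom, and in which no eigenvariable used occurs in $T$. **Approximations.** For a positive integer $n$, $\Gamma\Rightarrow_{\frac1n}\Delta$ denotes the sequent $\bot,n\Gamma\Rightarrow n\Delta$. For $\mathcal{G}=\Gamma_1\Rightarrow\Delta_1\mid\cdots\mid\Gamma_r\Rightarrow\Delta_r$, $\mathcal{G}_{\frac1n}$ denotes $\Gamma_1\Rightarrow_{\frac1n}\Delta_1\mid\cdots\mid\Gamma_r\Rightarrow_{\frac1n}\Delta_r$. In (b), the list $C_1,\dots,C_k$ may be empty ($k=0$), in which case the displayed hypersequent is just $\mathcal{G}_{\frac1n}$.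
   Formalization: The implication from (a) to (c) is proved only when the hypersequent is nonempty and infinitely many free variables do not occur in T; without these it is false (e.g. T containing P(a) for every free variable a). (a)⇔(b) and (c)⇒(a) are proved without these conditions. *)

theory Defs
  imports Complex_Main "HOL-Library.Multiset" "HOL-Library.Countable_Set"
    "HOL-Library.Extended_Real"
begin

section \<open>Syntax\<close>

text \<open>Constants are the function symbols of arity 0. The symbols of a language form sets rather
  than whole types, so that a language may lack predicate or function symbols.\<close>

record ('f, 'p) language =
  funs :: "'f set"
  preds :: "'p set"
  fun_arity :: "'f \<Rightarrow> nat"
  pred_arity :: "'p \<Rightarrow> nat"

definition countable_language :: "('f, 'p) language \<Rightarrow> bool" where
  "countable_language L \<longleftrightarrow> countable (funs L) \<and> countable (preds L)"

text \<open>Free and bound variables are two disjoint copies of the natural numbers. The two datatypes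
  are raw expressions, with no arity or variable discipline; the terms and formulas of a language
  are singled out by the predicates \<open>lterm\<close> and \<open>formula\<close>.\<close>

datatype 'f semiterm = FVar nat | BVar nat | Fn 'f "'f semiterm list"

datatype ('f, 'p) semiformula =
    Bot
  | Pred 'p "'f semiterm list"
  | Imp "('f, 'p) semiformula" "('f, 'p) semiformula"
  | All nat "('f, 'p) semiformula"
  | Ex nat "('f, 'p) semiformula"

fun fvars_term :: "'f semiterm \<Rightarrow> nat set" where
  "fvars_term (FVar a) = {a}"
| "fvars_term (BVar x) = {}"
| "fvars_term (Fn f ts) = (\<Union>t\<in>set ts. fvars_term t)"

fun bvars_term :: "'f semiterm \<Rightarrow> nat set" where
  "bvars_term (FVar a) = {}"
| "bvars_term (BVar x) = {x}"
| "bvars_term (Fn f ts) = (\<Union>t\<in>set ts. bvars_term t)"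

fun fvars :: "('f, 'p) semiformula \<Rightarrow> nat set" where
  "fvars Bot = {}"
| "fvars (Pred p ts) = (\<Union>t\<in>set ts. fvars_term t)"
| "fvars (Imp A B) = fvars A \<union> fvars B"
| "fvars (All x A) = fvars A"
| "fvars (Ex x A) = fvars A"

text \<open>All bound variables that occur, whether or not in the scope of a quantifier, and including
  the variable attached to a quantifier.\<close>

fun bvars :: "('f, 'p) semiformula \<Rightarrow> nat set" where
  "bvars Bot = {}"
| "bvars (Pred p ts) = (\<Union>t\<in>set ts. bvars_term t)"
| "bvars (Imp A B) = bvars A \<union> bvars B"
| "bvars (All x A) = insert x (bvars A)"
| "bvars (Ex x A) = insert x (bvars A)"

text \<open>\<open>abstract x a A\<close> is $A[x/a]$: every occurrence of the free variable \<open>a\<close> becomes the bound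
  variable \<open>x\<close>.\<close>

fun abstract_term :: "nat \<Rightarrow> nat \<Rightarrow> 'f semiterm \<Rightarrow> 'f semiterm" where
  "abstract_term x a (FVar b) = (if b = a then BVar x else FVar b)"
| "abstract_term x a (BVar y) = BVar y"
| "abstract_term x a (Fn f ts) = Fn f (map (abstract_term x a) ts)"

fun abstract :: "nat \<Rightarrow> nat \<Rightarrow> ('f, 'p) semiformula \<Rightarrow> ('f, 'p) semiformula" where
  "abstract x a Bot = Bot"
| "abstract x a (Pred p ts) = Pred p (map (abstract_term x a) ts)"
| "abstract x a (Imp A B) = Imp (abstract x a A) (abstract x a B)"
| "abstract x a (All y A) = All y (abstract x a A)"
| "abstract x a (Ex y A) = Ex y (abstract x a A)"

text \<open>\<open>inst x t A\<close> is $A(t)$ for $A = A(x)$: the free occurrences of the bound variable \<open>x\<close> are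
  replaced by \<open>t\<close>. It is used only for terms \<open>t\<close> without bound variables, so nothing is captured.\<close>

fun inst_term :: "nat \<Rightarrow> 'f semiterm \<Rightarrow> 'f semiterm \<Rightarrow> 'f semiterm" where
  "inst_term x t (FVar a) = FVar a"
| "inst_term x t (BVar y) = (if y = x then t else BVar y)"
| "inst_term x t (Fn f ts) = Fn f (map (inst_term x t) ts)"

fun inst :: "nat \<Rightarrow> 'f semiterm \<Rightarrow> ('f, 'p) semiformula \<Rightarrow> ('f, 'p) semiformula" where
  "inst x t Bot = Bot"
| "inst x t (Pred p ts) = Pred p (map (inst_term x t) ts)"
| "inst x t (Imp A B) = Imp (inst x t A) (inst x t B)"
| "inst x t (All y A) = All y (if y = x then A else inst x t A)"
| "inst x t (Ex y A) = Ex y (if y = x then A else inst x t A)"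

inductive lterm :: "('f, 'p) language \<Rightarrow> 'f semiterm \<Rightarrow> bool" for L where
  "lterm L (FVar a)"
| "\<lbrakk>f \<in> funs L; length ts = fun_arity L f; \<forall>t\<in>set ts. lterm L t\<rbrakk> \<Longrightarrow> lterm L (Fn f ts)"

inductive formula :: "('f, 'p) language \<Rightarrow> ('f, 'p) semiformula \<Rightarrow> bool" for L where
  "formula L Bot"
| "\<lbrakk>p \<in> preds L; length ts = pred_arity L p; \<forall>t\<in>set ts. lterm L t\<rbrakk> \<Longrightarrow> formula L (Pred p ts)"
| "\<lbrakk>formula L A; formula L B\<rbrakk> \<Longrightarrow> formula L (Imp A B)"
| "\<lbrakk>formula L A; x \<notin> bvars A\<rbrakk> \<Longrightarrow> formula L (All x (abstract x a A))"
| "\<lbrakk>formula L A; x \<notin> bvars A\<rbrakk> \<Longrightarrow> formula L (Ex x (abstract x a A))"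

text \<open>The pair \<open>(\<Gamma>, \<Delta>)\<close> is the sequent $\Gamma \Rightarrow \Delta$.\<close>

type_synonym ('f, 'p) sequent =
  "('f, 'p) semiformula multiset \<times> ('f, 'p) semiformula multiset"
type_synonym ('f, 'p) hypersequent = "('f, 'p) sequent multiset"

definition lsequent :: "('f, 'p) language \<Rightarrow> ('f, 'p) sequent \<Rightarrow> bool" where
  "lsequent L S \<longleftrightarrow> (\<forall>A\<in>#fst S. formula L A) \<and> (\<forall>A\<in>#snd S. formula L A)"

definition lhypersequent :: "('f, 'p) language \<Rightarrow> ('f, 'p) hypersequent \<Rightarrow> bool" where
  "lhypersequent L G \<longleftrightarrow> (\<forall>S\<in>#G. lsequent L S)"

definition ltheory :: "('f, 'p) language \<Rightarrow> ('f, 'p) semiformula set \<Rightarrow> bool" where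
  "ltheory L T \<longleftrightarrow> (\<forall>A\<in>T. formula L A)"

definition fvars_theory :: "('f, 'p) semiformula set \<Rightarrow> nat set" where
  "fvars_theory T = (\<Union>A\<in>T. fvars A)"

definition fvars_sequent :: "('f, 'p) sequent \<Rightarrow> nat set" where
  "fvars_sequent S = (\<Union>A\<in>set_mset (fst S) \<union> set_mset (snd S). fvars A)"

definition fvars_hypersequent :: "('f, 'p) hypersequent \<Rightarrow> nat set" where
  "fvars_hypersequent G = (\<Union>S\<in>set_mset G. fvars_sequent S)"

definition of_formula :: "('f, 'p) semiformula \<Rightarrow> ('f, 'p) hypersequent" where
  "of_formula A = {#({#}, {#A#})#}"


section \<open>Affine semantics\<close>

text \<open>The universe is a set of elements of the type \<open>'m\<close>.\<close>

record ('f, 'p, 'm) interp =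
  univ :: "'m set"
  fun_val :: "'f \<Rightarrow> 'm list \<Rightarrow> 'm"
  pred_val :: "'p \<Rightarrow> 'm list \<Rightarrow> real"
  fassign :: "nat \<Rightarrow> 'm"
  bassign :: "nat \<Rightarrow> 'm"

definition interpretation01 :: "('f, 'p) language \<Rightarrow> ('f, 'p, 'm) interp \<Rightarrow> bool" where
  "interpretation01 L I \<longleftrightarrow>
     univ I \<noteq> {} \<and>
     (\<forall>f\<in>funs L. \<forall>ms. length ms = fun_arity L f \<and> set ms \<subseteq> univ I \<longrightarrow> fun_val I f ms \<in> univ I) \<and>
     (\<forall>p\<in>preds L. \<forall>ms. length ms = pred_arity L p \<and> set ms \<subseteq> univ I \<longrightarrow> pred_val I p ms \<in> {0..1}) \<and>
     (\<forall>a. fassign I a \<in> univ I) \<and>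
     (\<forall>x. bassign I x \<in> univ I)"

fun term_val :: "('f, 'p, 'm) interp \<Rightarrow> 'f semiterm \<Rightarrow> 'm" where
  "term_val I (FVar a) = fassign I a"
| "term_val I (BVar x) = bassign I x"
| "term_val I (Fn f ts) = fun_val I f (map (term_val I) ts)"

fun truth_val :: "('f, 'p, 'm) interp \<Rightarrow> ('f, 'p) semiformula \<Rightarrow> real" where
  "truth_val I Bot = 1"
| "truth_val I (Pred p ts) = pred_val I p (map (term_val I) ts)"
| "truth_val I (Imp A B) = max (truth_val I B - truth_val I A) 0"
| "truth_val I (All x A) = (SUP m\<in>univ I. truth_val (I\<lparr>bassign := (bassign I)(x := m)\<rparr>) A)"
| "truth_val I (Ex x A) = (INF m\<in>univ I. truth_val (I\<lparr>bassign := (bassign I)(x := m)\<rparr>) A)"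

definition mset_val :: "('f, 'p, 'm) interp \<Rightarrow> ('f, 'p) semiformula multiset \<Rightarrow> real" where
  "mset_val I \<Gamma> = (\<Sum>A\<in>#\<Gamma>. truth_val I A)"

definition sequent_val :: "('f, 'p, 'm) interp \<Rightarrow> ('f, 'p) sequent \<Rightarrow> real" where
  "sequent_val I S = mset_val I (snd S) - mset_val I (fst S)"

text \<open>Extended reals, so that the empty hypersequent has the value $\inf\emptyset = \infty$ (and is
  never true).\<close>

definition hypersequent_val :: "('f, 'p, 'm) interp \<Rightarrow> ('f, 'p) hypersequent \<Rightarrow> ereal" where
  "hypersequent_val I G = (INF S\<in>set_mset G. ereal (sequent_val I S))"

definition true_in :: "('f, 'p, 'm) interp \<Rightarrow> ('f, 'p) hypersequent \<Rightarrow> bool" where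
  "true_in I G \<longleftrightarrow> hypersequent_val I G \<le> 0"

definition model01 ::
    "('f, 'p) language \<Rightarrow> ('f, 'p) semiformula set \<Rightarrow> ('f, 'p, 'm) interp \<Rightarrow> bool" where
  "model01 L T I \<longleftrightarrow> interpretation01 L I \<and> (\<forall>C\<in>T. true_in I (of_formula C))"

text \<open>Consequence over all models whose universe is a nonempty set of elements of \<open>'m\<close>. Since HOL
  cannot quantify over types inside a formula, \<open>'m\<close> is a parameter.\<close>

definition entails01 ::
    "'m itself \<Rightarrow> ('f, 'p) language \<Rightarrow> ('f, 'p) semiformula set \<Rightarrow> ('f, 'p) hypersequent \<Rightarrow> bool" where
  "entails01 TYPE('m) L T G \<longleftrightarrow> (\<forall>I :: ('f, 'p, 'm) interp. model01 L T I \<longrightarrow> true_in I G)"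


section \<open>The calculi\<close>

text \<open>A calculus relates the list of premises, the set of eigenvariables (empty or a singleton) and
  the conclusion of each of its inferences; axioms are inferences without premises.\<close>

type_synonym ('f, 'p) calculus =
  "('f, 'p) hypersequent list \<Rightarrow> nat set \<Rightarrow> ('f, 'p) hypersequent \<Rightarrow> bool"

inductive GL :: "('f, 'p) language \<Rightarrow> ('f, 'p) calculus" for L where
  ID: "GL L [] {} {#({#A#}, {#A#})#}"
| EMP: "GL L [] {} {#({#}, {#})#}"
| Bot: "GL L [] {} {#({#Bot#}, {#A#})#}"
| EW: "G \<noteq> {#} \<Longrightarrow> GL L [G] {} (add_mset (\<Gamma>, \<Delta>) G)"
| EC: "GL L [add_mset (\<Gamma>, \<Delta>) (add_mset (\<Gamma>, \<Delta>) G)] {} (add_mset (\<Gamma>, \<Delta>) G)"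
| IW: "GL L [add_mset (\<Gamma>, \<Delta>) G] {} (add_mset (add_mset A \<Gamma>, \<Delta>) G)"
| S: "GL L [add_mset (\<Gamma>1 + \<Gamma>2, \<Delta>1 + \<Delta>2) G] {} (add_mset (\<Gamma>1, \<Delta>1) (add_mset (\<Gamma>2, \<Delta>2) G))"
| M: "GL L [add_mset (\<Gamma>1, \<Delta>1) G, add_mset (\<Gamma>2, \<Delta>2) G] {} (add_mset (\<Gamma>1 + \<Gamma>2, \<Delta>1 + \<Delta>2) G)"
| ImpL: "GL L [add_mset (\<Gamma>, \<Delta>) (add_mset (add_mset B \<Gamma>, add_mset A \<Delta>) G)] {}
           (add_mset (add_mset (Imp A B) \<Gamma>, \<Delta>) G)"
| ImpR: "GL L [add_mset (\<Gamma>, \<Delta>) G, add_mset (add_mset A \<Gamma>, add_mset B \<Delta>) G] {}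
           (add_mset (\<Gamma>, add_mset (Imp A B) \<Delta>) G)"
| AllL: "lterm L t \<Longrightarrow>
         GL L [add_mset (add_mset (inst x t A) \<Gamma>, \<Delta>) G] {}
           (add_mset (add_mset (All x A) \<Gamma>, \<Delta>) G)"
| AllR: "a \<notin> fvars_hypersequent (add_mset (\<Gamma>, add_mset (All x A) \<Delta>) G) \<Longrightarrow>
         GL L [add_mset (\<Gamma>, add_mset (inst x (FVar a) A) \<Delta>) G] {a}
           (add_mset (\<Gamma>, add_mset (All x A) \<Delta>) G)"
| ExL: "a \<notin> fvars_hypersequent (add_mset (add_mset (Ex x A) \<Gamma>, \<Delta>) G) \<Longrightarrow>
         GL L [add_mset (add_mset (inst x (FVar a) A) \<Gamma>, \<Delta>) G] {a}
           (add_mset (add_mset (Ex x A) \<Gamma>, \<Delta>) G)"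
| ExR: "lterm L t \<Longrightarrow>
         GL L [add_mset (\<Gamma>, add_mset (inst x t A) \<Delta>) G] {}
           (add_mset (\<Gamma>, add_mset (Ex x A) \<Delta>) G)"

inductive sCut :: "('f, 'p) calculus" where
  "G \<noteq> {#} \<Longrightarrow> sCut [add_mset (\<Gamma>, \<Delta>) G, add_mset (\<Delta>, add_mset Bot \<Gamma>) G] {} G"

definition GL_sCut :: "('f, 'p) language \<Rightarrow> ('f, 'p) calculus" where
  "GL_sCut L Ps E G \<longleftrightarrow> GL L Ps E G \<or> sCut Ps E G"

text \<open>The condition \<open>lhypersequent L G\<close> makes every node of a derivation a hypersequent of the
  language; the calculi above are given by schemes over raw expressions.\<close>

inductive derivable_from ::
    "('f, 'p) language \<Rightarrow> ('f, 'p) calculus \<Rightarrow> ('f, 'p) semiformula set \<Rightarrow> ('f, 'p) hypersequent \<Rightarrow> bool"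
  for L C T where
  axiom: "A \<in> T \<Longrightarrow> lhypersequent L (of_formula A) \<Longrightarrow> derivable_from L C T (of_formula A)"
| step: "\<lbrakk>C Ps E G; lhypersequent L G; E \<inter> fvars_theory T = {}; \<forall>P\<in>set Ps. derivable_from L C T P\<rbrakk> \<Longrightarrow>
         derivable_from L C T G"

abbreviation derivable ::
    "('f, 'p) language \<Rightarrow> ('f, 'p) calculus \<Rightarrow> ('f, 'p) hypersequent \<Rightarrow> bool" where
  "derivable L C \<equiv> derivable_from L C {}"


section \<open>Approximations\<close>

definition approx_sequent :: "nat \<Rightarrow> ('f, 'p) sequent \<Rightarrow> ('f, 'p) sequent" where
  "approx_sequent n S = (add_mset Bot (repeat_mset n (fst S)), repeat_mset n (snd S))"

definition approx :: "nat \<Rightarrow> ('f, 'p) hypersequent \<Rightarrow> ('f, 'p) hypersequent" where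
  "approx n G = image_mset (approx_sequent n) G"

end

theory Submission
  imports Defs "HOL-Library.Product_Plus"
begin

text \<open>The directions from the calculi to the semantics are soundness. In a model of \<open>T\<close> every
\<open>C \<in> T\<close> has the value 0, so the sequent \<open>m C \<Rightarrow>\<^bsub>1/n\<^esub> \<bottom>\<close> has the value \<open>n - 1\<close>, which is positive once
\<open>n \<ge> 2\<close>; the truth of the hypersequent in (b) must then come from the approximation of \<open>G\<close>. If the
approximations of \<open>G\<close> are true for all \<open>n \<ge> 2\<close>, some component of \<open>G\<close> has a value \<open>\<le> 0\<close>, because
\<open>G\<close> is finite.

The main point is that (a) implies (b), a completeness theorem for the cut-free calculus. It is
proved by a direct Henkin-Hintikka construction, without cut elimination. Suppose that for some
\<open>n\<close> no hypersequent as in (b) is derivable. By (EW) and (EC) derivability depends only on the set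
of components, so the components of the approximation of \<open>G\<close> together with all
\<open>m C \<Rightarrow>\<^bsub>1/n\<^esub> \<bottom>\<close> form a set from which no derivable hypersequent can be formed. After a renaming that
sets infinitely many variables free, this set extends to a maximal such set \<open>H\<close> with eigenvariables
as witnesses (\<open>exists_max_consistent\<close>); \<open>H\<close> is closed under reading the logical rules upwards.

The structural rules then yield real values. By (S) no nonempty sum of sequents of \<open>H\<close> is a
derivable sequent, so the sequents of \<open>H\<close>, thought of as formal differences \<open>\<Delta> - \<Gamma>\<close>, extend to the positive
part of a total preorder that is compatible with addition. Comparing multiples of a formula \<open>A\<close> with
multiples of \<open>\<bottom>\<close> in this order is a Dedekind cut; it gives a real \<open>v A\<close> in \<open>[0,1]\<close>, and
\<open>v \<Gamma> \<le> v \<Delta>\<close> for all sequents of \<open>H\<close> (\<open>exists_valuation\<close>). This plays the role of the theorem of the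
alternative and of compactness in one step. The term model takes the values of \<open>v\<close> on atomic formulas
only, and since \<open>H\<close> is closed under the logical rules read upwards, the inequality holds in the term
model for all sequents of \<open>H\<close> (\<open>truth_lemma\<close>).

The order only gives non-strict inequalities, and here the approximations matter: the value of
\<open>\<bottom>, n\<Gamma> \<Rightarrow> n\<Delta>\<close> is nonnegative iff the value of \<open>\<Gamma> \<Rightarrow> \<Delta>\<close> is at least \<open>1/n\<close>. So \<open>G\<close> is not true in the
term model, while \<open>n (1 - m v) \<ge> 1\<close> for all \<open>m\<close> forces the value \<open>v\<close> of each \<open>C \<in> T\<close> to be 0.

For (c), the derivation from (b) is renamed so that its eigenvariables avoid \<open>T\<close>. For \<open>n \<ge> 2\<close> the
axiom \<open>\<Rightarrow> C\<close> yields \<open>(n-1)\<bottom> \<Rightarrow> \<bottom>, nmC\<close>, the converse of \<open>m C \<Rightarrow>\<^bsub>1/n\<^esub> \<bottom>\<close> in the sense of (s-Cut), so the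
sequents that mention \<open>T\<close> can be cut away. The case \<open>n = 1\<close> follows from \<open>n = 2\<close>.\<close>

section \<open>Formulas as well-scoped expressions\<close>

text \<open>The bound variables in scope are collected in \<open>V\<close>. In contrast to the inductive definition of
formulas, which closes off one free variable at a time, this description is stable under passing to
the body of a quantifier.\<close>

fun wf_term :: "('f, 'p) language \<Rightarrow> nat set \<Rightarrow> 'f semiterm \<Rightarrow> bool" where
  "wf_term L V (FVar a) \<longleftrightarrow> True"
| "wf_term L V (BVar x) \<longleftrightarrow> x \<in> V"
| "wf_term L V (Fn f ts) \<longleftrightarrow>
     f \<in> funs L \<and> length ts = fun_arity L f \<and> (\<forall>t\<in>set ts. wf_term L V t)"

text \<open>The condition \<open>x \<notin> V\<close> reflects that \<open>\<forall>x A[x/a]\<close> is formed only if \<open>x\<close> does not occur in \<open>A\<close>,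
so that no quantifier is in the scope of another one with the same variable.\<close>

fun wf_formula :: "('f, 'p) language \<Rightarrow> nat set \<Rightarrow> ('f, 'p) semiformula \<Rightarrow> bool" where
  "wf_formula L V Bot \<longleftrightarrow> True"
| "wf_formula L V (Pred p ts) \<longleftrightarrow>
     p \<in> preds L \<and> length ts = pred_arity L p \<and> (\<forall>t\<in>set ts. wf_term L V t)"
| "wf_formula L V (Imp A B) \<longleftrightarrow> wf_formula L V A \<and> wf_formula L V B"
| "wf_formula L V (All x A) \<longleftrightarrow> x \<notin> V \<and> wf_formula L (insert x V) A"
| "wf_formula L V (Ex x A) \<longleftrightarrow> x \<notin> V \<and> wf_formula L (insert x V) A"

lemma lterm_iff_wf_term: "lterm L t \<longleftrightarrow> wf_term L {} t"
proof
  assume "lterm L t" then show "wf_term L {} t" by induction auto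
next
  assume "wf_term L {} t" then show "lterm L t" by (induction t) (auto intro: lterm.intros)
qed

lemma wf_term_mono: "wf_term L V t \<Longrightarrow> V \<subseteq> W \<Longrightarrow> wf_term L W t"
  by (induction t) auto

lemma wf_term_inst: "wf_term L (insert x V) s \<Longrightarrow> wf_term L {} t \<Longrightarrow> wf_term L V (inst_term x t s)"
  by (induction s) (auto intro: wf_term_mono)

lemma wf_formula_inst:
  "wf_formula L (insert x V) A \<Longrightarrow> x \<notin> V \<Longrightarrow> wf_term L {} t \<Longrightarrow> wf_formula L V (inst x t A)"
proof (induction A arbitrary: V)
  case (All y A)
  then show ?case using All.IH[of "insert y V"] by (auto simp: insert_commute)
next
  case (Ex y A)
  then show ?case using Ex.IH[of "insert y V"] by (auto simp: insert_commute)
qed (auto intro: wf_term_inst)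

lemma wf_term_abstract: "wf_term L V s \<Longrightarrow> wf_term L (insert x V) (abstract_term x a s)"
  by (induction s) auto

lemma wf_formula_abstract:
  "wf_formula L V A \<Longrightarrow> x \<notin> bvars A \<Longrightarrow> wf_formula L (insert x V) (abstract x a A)"
proof (induction A arbitrary: V)
  case (All y A)
  then show ?case using All.IH[of "insert y V"] by (auto simp: insert_commute)
next
  case (Ex y A)
  then show ?case using Ex.IH[of "insert y V"] by (auto simp: insert_commute)
qed (auto intro: wf_term_abstract)

lemma abstract_term_inst_term:
  "a \<notin> fvars_term s \<Longrightarrow> abstract_term x a (inst_term x (FVar a) s) = s"
  by (induction s) (auto intro: map_idI)

text \<open>Well-scopedness excludes a second binder for \<open>x\<close> inside \<open>A\<close>; this is why instantiation by a
fresh free variable can be undone.\<close>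

lemma abstract_inst:
  "wf_formula L (insert x V) A \<Longrightarrow> a \<notin> fvars A \<Longrightarrow> abstract x a (inst x (FVar a) A) = A"
proof (induction A arbitrary: V)
  case (All y A)
  then show ?case using All.IH[of "insert y V"] by (auto simp: insert_commute)
next
  case (Ex y A)
  then show ?case using Ex.IH[of "insert y V"] by (auto simp: insert_commute)
qed (auto intro!: map_idI abstract_term_inst_term)

lemma bvars_term_inst_term: "x \<notin> bvars_term (inst_term x (FVar a) s)"
  by (induction s) auto

lemma bvars_inst: "wf_formula L (insert x V) A \<Longrightarrow> x \<notin> bvars (inst x (FVar a) A)"
proof (induction A arbitrary: V)
  case (All y A)
  then show ?case using All.IH[of "insert y V"] by (auto simp: insert_commute)
next
  case (Ex y A)
  then show ?case using Ex.IH[of "insert y V"] by (auto simp: insert_commute)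
qed (auto simp: bvars_term_inst_term)

lemma finite_fvars_term: "finite (fvars_term t)"
  by (induction t) auto

lemma finite_fvars: "finite (fvars A)"
  by (induction A) (auto simp: finite_fvars_term)

text \<open>The measure for inductions in which the body of a quantifier is replaced by an instance.\<close>

fun connectives :: "('f, 'p) semiformula \<Rightarrow> nat" where
  "connectives Bot = 0"
| "connectives (Pred p ts) = 0"
| "connectives (Imp A B) = Suc (connectives A + connectives B)"
| "connectives (All x A) = Suc (connectives A)"
| "connectives (Ex x A) = Suc (connectives A)"

lemma connectives_inst [simp]: "connectives (inst x t A) = connectives A"
  by (induction A) auto

text \<open>From right to left, the body of a quantifier is first turned into a formula by putting a fresh
free variable for the bound one; abstracting that variable again gives the body back.\<close>

lemma formula_iff_wf_formula: "formula L A \<longleftrightarrow> wf_formula L {} A"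
proof
  assume "formula L A" then show "wf_formula L {} A"
    by induction (auto simp: lterm_iff_wf_term intro: wf_formula_abstract)
next
  assume "wf_formula L {} A" then show "formula L A"
  proof (induction "connectives A" arbitrary: A rule: less_induct)
    case less
    have body: "\<exists>B a. formula L B \<and> x \<notin> bvars B \<and> C = abstract x a B"
      if C: "wf_formula L {x} C" and "connectives C < connectives A" for x C
    proof -
      obtain a where a: "a \<notin> fvars C"
        using ex_new_if_finite[OF infinite_UNIV_nat finite_fvars] by blast
      have "formula L (inst x (FVar a) C)"
        using less.hyps[of "inst x (FVar a) C"] wf_formula_inst[of L x "{}" C "FVar a"] that by simp
      then show ?thesis
        using abstract_inst[of L x "{}" C a] bvars_inst[of L x "{}" C a] C a by metis
    qed
    show ?case
    proof (cases A)
      case (All x C)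
      with less.prems body[of x C] show ?thesis by (auto intro: formula.intros)
    next
      case (Ex x C)
      with less.prems body[of x C] show ?thesis by (auto intro: formula.intros)
    qed (use less in \<open>auto simp: lterm_iff_wf_term intro!: formula.intros\<close>)
  qed
qed

lemma formula_simps [simp]:
  "formula L Bot"
  "formula L (Imp A B) \<longleftrightarrow> formula L A \<and> formula L B"
  by (simp_all add: formula_iff_wf_formula)

lemma formula_inst:
  "formula L (All x A) \<Longrightarrow> lterm L t \<Longrightarrow> formula L (inst x t A)"
  "formula L (Ex x A) \<Longrightarrow> lterm L t \<Longrightarrow> formula L (inst x t A)"
  by (auto simp: formula_iff_wf_formula lterm_iff_wf_term intro: wf_formula_inst)

section \<open>Renaming free variables\<close>

fun ren_term :: "(nat \<Rightarrow> nat) \<Rightarrow> 'f semiterm \<Rightarrow> 'f semiterm" where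
  "ren_term \<rho> (FVar a) = FVar (\<rho> a)"
| "ren_term \<rho> (BVar x) = BVar x"
| "ren_term \<rho> (Fn f ts) = Fn f (map (ren_term \<rho>) ts)"

fun ren :: "(nat \<Rightarrow> nat) \<Rightarrow> ('f, 'p) semiformula \<Rightarrow> ('f, 'p) semiformula" where
  "ren \<rho> Bot = Bot"
| "ren \<rho> (Pred p ts) = Pred p (map (ren_term \<rho>) ts)"
| "ren \<rho> (Imp A B) = Imp (ren \<rho> A) (ren \<rho> B)"
| "ren \<rho> (All x A) = All x (ren \<rho> A)"
| "ren \<rho> (Ex x A) = Ex x (ren \<rho> A)"

lemma ren_term_inst_term: "ren_term \<rho> (inst_term x t s) = inst_term x (ren_term \<rho> t) (ren_term \<rho> s)"
  by (induction s) auto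

lemma ren_inst: "ren \<rho> (inst x t A) = inst x (ren_term \<rho> t) (ren \<rho> A)"
  by (induction A) (auto simp: ren_term_inst_term)

lemma wf_term_ren: "wf_term L V s \<Longrightarrow> wf_term L V (ren_term \<rho> s)"
  by (induction s) auto

lemma lterm_ren: "lterm L t \<Longrightarrow> lterm L (ren_term \<rho> t)"
  by (simp add: lterm_iff_wf_term wf_term_ren)

lemma formula_ren: "formula L A \<Longrightarrow> formula L (ren \<rho> A)"
proof -
  have "wf_formula L V A \<Longrightarrow> wf_formula L V (ren \<rho> A)" for V
    by (induction A arbitrary: V) (auto simp: wf_term_ren)
  then show "formula L A \<Longrightarrow> formula L (ren \<rho> A)" by (simp add: formula_iff_wf_formula)
qed

lemma fvars_term_ren: "fvars_term (ren_term \<rho> t) = \<rho> ` fvars_term t"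
  by (induction t) auto

lemma fvars_ren: "fvars (ren \<rho> A) = \<rho> ` fvars A"
  by (induction A) (auto simp: fvars_term_ren image_UN)

lemma ren_term_cong: "(\<And>a. a \<in> fvars_term t \<Longrightarrow> \<rho> a = \<sigma> a) \<Longrightarrow> ren_term \<rho> t = ren_term \<sigma> t"
  by (induction t) auto

lemma ren_cong: "(\<And>a. a \<in> fvars A \<Longrightarrow> \<rho> a = \<sigma> a) \<Longrightarrow> ren \<rho> A = ren \<sigma> A"
  by (induction A) (auto intro!: ren_term_cong)

lemma ren_term_ren_term: "ren_term \<rho> (ren_term \<sigma> t) = ren_term (\<lambda>a. \<rho> (\<sigma> a)) t"
  by (induction t) auto

lemma ren_ren: "ren \<rho> (ren \<sigma> A) = ren (\<lambda>a. \<rho> (\<sigma> a)) A"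
  by (induction A) (auto simp: ren_term_ren_term)

lemma ren_term_id: "ren_term (\<lambda>a. a) t = t"
  by (induction t) (auto intro: map_idI)

lemma ren_id: "ren (\<lambda>a. a) A = A"
  by (induction A) (auto simp: ren_term_id intro: map_idI)

definition ren_sequent :: "(nat \<Rightarrow> nat) \<Rightarrow> ('f, 'p) sequent \<Rightarrow> ('f, 'p) sequent" where
  "ren_sequent \<rho> = map_prod (image_mset (ren \<rho>)) (image_mset (ren \<rho>))"

lemma ren_sequent_simp [simp]:
  "ren_sequent \<rho> (\<Gamma>, \<Delta>) = (image_mset (ren \<rho>) \<Gamma>, image_mset (ren \<rho>) \<Delta>)"
  by (simp add: ren_sequent_def)

lemma ren_sequent_cong:
  "(\<And>a. a \<in> fvars_sequent S \<Longrightarrow> \<rho> a = \<sigma> a) \<Longrightarrow> ren_sequent \<rho> S = ren_sequent \<sigma> S"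
  by (cases S) (force simp: fvars_sequent_def intro!: image_mset_cong ren_cong)

lemma ren_sequent_ren_sequent: "ren_sequent \<rho> (ren_sequent \<sigma> S) = ren_sequent (\<lambda>a. \<rho> (\<sigma> a)) S"
  by (cases S) (simp add: multiset.map_comp comp_def ren_ren)

lemma ren_sequent_id: "ren_sequent (\<lambda>a. a) S = S"
  by (cases S) (simp add: ren_id multiset.map_ident_strong)

lemma fvars_ren_sequent: "fvars_sequent (ren_sequent \<rho> S) = \<rho> ` fvars_sequent S"
  by (cases S) (auto simp: fvars_sequent_def fvars_ren)

lemma lsequent_ren: "lsequent L S \<Longrightarrow> lsequent L (ren_sequent \<rho> S)"
  by (cases S) (auto simp: lsequent_def formula_ren)

lemma finite_fvars_sequent: "finite (fvars_sequent S)"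
  by (auto simp: fvars_sequent_def finite_fvars)

lemma finite_fvars_hypersequent: "finite (fvars_hypersequent G)"
  by (auto simp: fvars_hypersequent_def finite_fvars_sequent)

lemma lsequent_simps [simp]:
  "lsequent L (\<Gamma>, add_mset A \<Delta>) \<longleftrightarrow> formula L A \<and> lsequent L (\<Gamma>, \<Delta>)"
  "lsequent L (add_mset A \<Gamma>, \<Delta>) \<longleftrightarrow> formula L A \<and> lsequent L (\<Gamma>, \<Delta>)"
  "lsequent L ({#}, {#})"
  by (auto simp: lsequent_def)

lemma lhypersequent_simps [simp]:
  "lhypersequent L {#}"
  "lhypersequent L (add_mset S G) \<longleftrightarrow> lsequent L S \<and> lhypersequent L G"
  "lhypersequent L (G + H) \<longleftrightarrow> lhypersequent L G \<and> lhypersequent L H"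
  by (auto simp: lhypersequent_def)

lemma lsequent_plus [simp]: "lsequent L (S + S') \<longleftrightarrow> lsequent L S \<and> lsequent L S'"
  by (cases S; cases S') (auto simp: lsequent_def)

section \<open>Affine truth values\<close>

lemma term_val_bassign:
  "bvars_term t = {} \<Longrightarrow> term_val (I\<lparr>bassign := b\<rparr>) t = term_val I t"
  by (induction t) (auto cong: map_cong)

lemma term_val_inst_term:
  "term_val I (inst_term x t s) = term_val (I\<lparr>bassign := (bassign I)(x := term_val I t)\<rparr>) s"
  by (induction s) (auto cong: map_cong simp: comp_def)

text \<open>No capture can occur because the substituted term has no bound variables.\<close>

lemma truth_val_inst:
  "bvars_term t = {} \<Longrightarrow>
     truth_val I (inst x t A) = truth_val (I\<lparr>bassign := (bassign I)(x := term_val I t)\<rparr>) A"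
proof (induction A arbitrary: I)
  case (All y A)
  show ?case
  proof (cases "y = x")
    case False
    have "truth_val (I\<lparr>bassign := (bassign I)(y := m)\<rparr>) (inst x t A)
        = truth_val (I\<lparr>bassign := (bassign I)(x := term_val I t, y := m)\<rparr>) A" for m
      unfolding All.IH[OF All.prems] using False All.prems
      by (auto simp: term_val_bassign intro!: arg_cong[where f = "\<lambda>b. truth_val (I\<lparr>bassign := b\<rparr>) A"])
    then show ?thesis using False by (simp add: fun_upd_def)
  qed (simp add: fun_upd_def cong: if_cong)
next
  case (Ex y A)
  show ?case
  proof (cases "y = x")
    case False
    have "truth_val (I\<lparr>bassign := (bassign I)(y := m)\<rparr>) (inst x t A)
        = truth_val (I\<lparr>bassign := (bassign I)(x := term_val I t, y := m)\<rparr>) A" for m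
      unfolding Ex.IH[OF Ex.prems] using False Ex.prems
      by (auto simp: term_val_bassign intro!: arg_cong[where f = "\<lambda>b. truth_val (I\<lparr>bassign := b\<rparr>) A"])
    then show ?thesis using False by (simp add: fun_upd_def)
  qed (simp add: fun_upd_def cong: if_cong)
qed (auto simp: term_val_inst_term comp_def)

lemma term_val_fassign_cong:
  "(\<And>a. a \<in> fvars_term t \<Longrightarrow> h a = fassign I a) \<Longrightarrow> term_val (I\<lparr>fassign := h\<rparr>) t = term_val I t"
proof (induction t)
  case (Fn f ts)
  then have "term_val (I\<lparr>fassign := h\<rparr>) t = term_val I t" if "t \<in> set ts" for t
    using that by force
  then show ?case by (simp cong: map_cong)
qed auto

lemma truth_val_fassign_cong:
  "(\<And>a. a \<in> fvars A \<Longrightarrow> h a = fassign I a) \<Longrightarrow> truth_val (I\<lparr>fassign := h\<rparr>) A = truth_val I A"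
proof (induction A arbitrary: I)
  case (Pred p ts)
  then have "term_val (I\<lparr>fassign := h\<rparr>) t = term_val I t" if "t \<in> set ts" for t
    using that by (intro term_val_fassign_cong) force
  then show ?case by (simp cong: map_cong)
next
  case (All y A)
  have "truth_val (I\<lparr>fassign := h, bassign := (bassign I)(y := m)\<rparr>) A
      = truth_val (I\<lparr>bassign := (bassign I)(y := m)\<rparr>) A" for m
    using All.IH[of "I\<lparr>bassign := (bassign I)(y := m)\<rparr>"] All.prems by (cases I) simp
  then show ?case by simp
next
  case (Ex y A)
  have "truth_val (I\<lparr>fassign := h, bassign := (bassign I)(y := m)\<rparr>) A
      = truth_val (I\<lparr>bassign := (bassign I)(y := m)\<rparr>) A" for m
    using Ex.IH[of "I\<lparr>bassign := (bassign I)(y := m)\<rparr>"] Ex.prems by (cases I) simp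
  then show ?case by simp
qed auto

lemma term_val_ren: "term_val I (ren_term \<rho> t) = term_val (I\<lparr>fassign := fassign I \<circ> \<rho>\<rparr>) t"
  by (induction t) (auto intro!: arg_cong[where f = "fun_val I _"])

lemma truth_val_ren: "truth_val I (ren \<rho> A) = truth_val (I\<lparr>fassign := fassign I \<circ> \<rho>\<rparr>) A"
proof (induction A arbitrary: I)
  case (Pred p ts)
  then show ?case by (auto intro!: arg_cong[where f = "pred_val I _"] term_val_ren[unfolded comp_def])
next
  case (All x A)
  have "truth_val (I\<lparr>bassign := (bassign I)(x := m)\<rparr>) (ren \<rho> A)
      = truth_val (I\<lparr>fassign := fassign I \<circ> \<rho>, bassign := (bassign I)(x := m)\<rparr>) A" for m
    unfolding All.IH by (cases I) simp
  then show ?case by (simp add: comp_def)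
next
  case (Ex x A)
  have "truth_val (I\<lparr>bassign := (bassign I)(x := m)\<rparr>) (ren \<rho> A)
      = truth_val (I\<lparr>fassign := fassign I \<circ> \<rho>, bassign := (bassign I)(x := m)\<rparr>) A" for m
    unfolding Ex.IH by (cases I) simp
  then show ?case by (simp add: comp_def)
qed auto

lemma interpretation01_bassign:
  "interpretation01 L I \<Longrightarrow> m \<in> univ I \<Longrightarrow> interpretation01 L (I\<lparr>bassign := (bassign I)(x := m)\<rparr>)"
  by (auto simp: interpretation01_def)

lemma interpretation01_fassign:
  "interpretation01 L I \<Longrightarrow> (\<And>a. h a \<in> univ I) \<Longrightarrow> interpretation01 L (I\<lparr>fassign := h\<rparr>)"
  by (auto simp: interpretation01_def)

lemma term_val_in_univ: "interpretation01 L I \<Longrightarrow> wf_term L V t \<Longrightarrow> term_val I t \<in> univ I"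
proof (induction t)
  case (Fn f ts)
  then have "set (map (term_val I) ts) \<subseteq> univ I" by auto
  with Fn.prems show ?case by (simp add: interpretation01_def)
qed (auto simp: interpretation01_def)

text \<open>The bounds are needed beyond formulas, namely for bodies of quantifiers: without them the suprema
and infima of reals in the definition of truth values would be meaningless.\<close>

lemma truth_val_bounds:
  "interpretation01 L I \<Longrightarrow> wf_formula L V A \<Longrightarrow> 0 \<le> truth_val I A \<and> truth_val I A \<le> 1"
proof (induction A arbitrary: I V)
  case (Pred p ts)
  then have "set (map (term_val I) ts) \<subseteq> univ I" by (auto intro: term_val_in_univ)
  with Pred.prems show ?case by (simp add: interpretation01_def)
next
  case (Imp A B)
  then show ?case by (fastforce simp: max_def)
next
  case (All x A)
  then obtain m where m: "m \<in> univ I" by (auto simp: interpretation01_def)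
  let ?v = "\<lambda>m. truth_val (I\<lparr>bassign := (bassign I)(x := m)\<rparr>) A"
  have b: "0 \<le> ?v m \<and> ?v m \<le> 1" if "m \<in> univ I" for m
    using All.IH[OF interpretation01_bassign[OF All.prems(1) that]] All.prems(2) by auto
  have "0 \<le> (SUP m\<in>univ I. ?v m)"
    using b m by (intro cSUP_upper2[OF _ m]) (auto intro!: bdd_aboveI2[where M = 1])
  moreover have "(SUP m\<in>univ I. ?v m) \<le> 1"
    using b m by (intro cSUP_least) auto
  ultimately show ?case by simp
next
  case (Ex x A)
  then obtain m where m: "m \<in> univ I" by (auto simp: interpretation01_def)
  let ?v = "\<lambda>m. truth_val (I\<lparr>bassign := (bassign I)(x := m)\<rparr>) A"
  have b: "0 \<le> ?v m \<and> ?v m \<le> 1" if "m \<in> univ I" for m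
    using Ex.IH[OF interpretation01_bassign[OF Ex.prems(1) that]] Ex.prems(2) by auto
  have "(INF m\<in>univ I. ?v m) \<le> 1"
    using b m by (intro cINF_lower2[OF _ m]) (auto intro!: bdd_belowI2[where m = 0])
  moreover have "0 \<le> (INF m\<in>univ I. ?v m)"
    using b m by (intro cINF_greatest) auto
  ultimately show ?case by simp
qed auto

lemma truth_val_formula:
  assumes "interpretation01 L I" "formula L A"
  shows "0 \<le> truth_val I A" "truth_val I A \<le> 1"
  using truth_val_bounds assms by (auto simp: formula_iff_wf_formula)

lemma truth_val_instances:
  assumes I: "interpretation01 L I" and A: "wf_formula L {x} A"
  defines "v \<equiv> \<lambda>m. truth_val (I\<lparr>bassign := (bassign I)(x := m)\<rparr>) A"
  shows "bdd_above (v ` univ I)" "bdd_below (v ` univ I)"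
  using truth_val_bounds[OF interpretation01_bassign[OF I] A] unfolding v_def
  by (auto intro!: bdd_aboveI2[where M = 1] bdd_belowI2[where m = 0])

lemma mset_val_simps [simp]:
  "mset_val I {#} = 0"
  "mset_val I (add_mset A \<Gamma>) = truth_val I A + mset_val I \<Gamma>"
  "mset_val I (\<Gamma> + \<Delta>) = mset_val I \<Gamma> + mset_val I \<Delta>"
  by (simp_all add: mset_val_def)

lemma mset_val_replicate [simp]: "mset_val I (replicate_mset n A) = real n * truth_val I A"
  by (induction n) (auto simp: algebra_simps)

lemma mset_val_repeat [simp]: "mset_val I (repeat_mset n \<Gamma>) = real n * mset_val I \<Gamma>"
  by (induction n) (auto simp: algebra_simps)

lemma sequent_val_simp [simp]: "sequent_val I (\<Gamma>, \<Delta>) = mset_val I \<Delta> - mset_val I \<Gamma>"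
  by (simp add: sequent_val_def)

lemma true_in_iff: "true_in I G \<longleftrightarrow> (\<exists>S\<in>#G. sequent_val I S \<le> 0)"
proof (cases "G = {#}")
  case True
  then show ?thesis by (simp add: true_in_def hypersequent_val_def top_ereal_def)
next
  case False
  let ?V = "(\<lambda>S. ereal (sequent_val I S)) ` set_mset G"
  have "Inf ?V \<in> ?V" using False by (simp add: cInf_eq_Min Min_in)
  then obtain S where S: "S \<in># G" "hypersequent_val I G = ereal (sequent_val I S)"
    by (auto simp: hypersequent_val_def)
  have "hypersequent_val I G \<le> ereal (sequent_val I R)" if "R \<in># G" for R
    using that by (auto simp: hypersequent_val_def intro: INF_lower)
  then have "sequent_val I S \<le> sequent_val I R" if "R \<in># G" for R
    using that S(2) by simp
  then show ?thesis
    using S by (fastforce simp: true_in_def)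
qed

lemma true_in_simps [simp]:
  "\<not> true_in I {#}"
  "true_in I (add_mset S G) \<longleftrightarrow> sequent_val I S \<le> 0 \<or> true_in I G"
  by (auto simp: true_in_iff)

lemma sequent_val_fassign_cong:
  assumes "\<And>a. a \<in> fvars_sequent S \<Longrightarrow> h a = fassign I a"
  shows "sequent_val (I\<lparr>fassign := h\<rparr>) S = sequent_val I S"
proof -
  have v: "truth_val (I\<lparr>fassign := h\<rparr>) A = truth_val I A" if "A \<in># fst S + snd S" for A
    using that assms by (intro truth_val_fassign_cong) (auto simp: fvars_sequent_def)
  have "mset_val (I\<lparr>fassign := h\<rparr>) \<Gamma> = mset_val I \<Gamma>" if "\<Gamma> = fst S \<or> \<Gamma> = snd S" for \<Gamma>
    unfolding mset_val_def using that
    by (intro arg_cong[where f = sum_mset] image_mset_cong v) auto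
  then show ?thesis by (simp add: sequent_val_def)
qed

lemma true_in_fassign_cong:
  assumes "\<And>a. a \<in> fvars_hypersequent G \<Longrightarrow> h a = fassign I a"
  shows "true_in (I\<lparr>fassign := h\<rparr>) G \<longleftrightarrow> true_in I G"
proof -
  have "sequent_val (I\<lparr>fassign := h\<rparr>) S = sequent_val I S" if "S \<in># G" for S
    using that assms by (intro sequent_val_fassign_cong) (auto simp: fvars_hypersequent_def)
  then show ?thesis by (simp add: true_in_iff)
qed

section \<open>Soundness\<close>

lemma model01_fassign:
  assumes "model01 L T I" "a \<notin> fvars_theory T" "m \<in> univ I"
  shows "model01 L T (I\<lparr>fassign := (fassign I)(a := m)\<rparr>)"
proof -
  have "true_in (I\<lparr>fassign := (fassign I)(a := m)\<rparr>) (of_formula C)" if "C \<in> T" for C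
  proof -
    have "b \<noteq> a" if "b \<in> fvars_hypersequent (of_formula C)" for b
      using that assms(2) \<open>C \<in> T\<close>
      by (auto simp: of_formula_def fvars_hypersequent_def fvars_sequent_def fvars_theory_def)
    then show ?thesis
      using assms(1) that by (subst true_in_fassign_cong) (auto simp: model01_def)
  qed
  then show ?thesis
    using assms interpretation01_fassign[of L I "(fassign I)(a := m)"]
    by (auto simp: model01_def interpretation01_def)
qed

text \<open>An eigenvariable can stand for an arbitrary element, since its value can be changed without
affecting anything else.\<close>

lemma truth_val_eigenvariable:
  assumes "a \<notin> fvars A"
  shows "truth_val (I\<lparr>fassign := (fassign I)(a := m)\<rparr>) (inst x (FVar a) A)
    = truth_val (I\<lparr>bassign := (bassign I)(x := m)\<rparr>) A"
proof -
  have "truth_val (I\<lparr>fassign := (fassign I)(a := m)\<rparr>) (inst x (FVar a) A)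
      = truth_val (I\<lparr>bassign := (bassign I)(x := m), fassign := (fassign I)(a := m)\<rparr>) A"
    by (subst truth_val_inst, simp, cases I, simp)
  also have "\<dots> = truth_val (I\<lparr>bassign := (bassign I)(x := m)\<rparr>) A"
    using assms by (subst truth_val_fassign_cong) auto
  finally show ?thesis .
qed

lemma derivable_from_lhypersequent: "derivable_from L C T H \<Longrightarrow> lhypersequent L H"
  by (erule derivable_from.cases) auto

lemma lterm_bvars: "lterm L t \<Longrightarrow> bvars_term t = {}"
  by (induction rule: lterm.induct) auto

lemma formula_quantifier:
  "formula L (All x A) \<Longrightarrow> wf_formula L {x} A"
  "formula L (Ex x A) \<Longrightarrow> wf_formula L {x} A"
  by (simp_all add: formula_iff_wf_formula)

lemma truth_val_quantifier_instance:
  assumes "interpretation01 L I" "lterm L t"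
  shows "formula L (All x A) \<Longrightarrow> truth_val I (inst x t A) \<le> truth_val I (All x A)"
    and "formula L (Ex x A) \<Longrightarrow> truth_val I (Ex x A) \<le> truth_val I (inst x t A)"
proof -
  have t: "term_val I t \<in> univ I"
    using assms term_val_in_univ by (auto simp: lterm_iff_wf_term)
  show "truth_val I (inst x t A) \<le> truth_val I (All x A)" if "formula L (All x A)"
    using truth_val_instances[OF assms(1) formula_quantifier(1)[OF that]] t
    by (auto simp: truth_val_inst lterm_bvars[OF assms(2)] intro!: cSUP_upper)
  show "truth_val I (Ex x A) \<le> truth_val I (inst x t A)" if "formula L (Ex x A)"
    using truth_val_instances[OF assms(1) formula_quantifier(2)[OF that]] t
    by (auto simp: truth_val_inst lterm_bvars[OF assms(2)] intro!: cINF_lower)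
qed

text \<open>If the conclusion is not true, the strict inequality for the supremum is already witnessed by one
element. Assigning this element to the eigenvariable refutes the premise, in an interpretation that is
still a model of \<open>T\<close>.\<close>

lemma all_right_sound:
  fixes I :: "('f, 'p, 'm) interp"
  assumes M: "model01 L T I" and A: "formula L (All x A)" and T: "a \<notin> fvars_theory T"
    and a: "a \<notin> fvars_hypersequent (add_mset (\<Gamma>, add_mset (All x A) \<Delta>) G)"
    and prem: "\<And>I :: ('f, 'p, 'm) interp. model01 L T I \<Longrightarrow> true_in I (add_mset (\<Gamma>, add_mset (inst x (FVar a) A) \<Delta>) G)"
  shows "true_in I (add_mset (\<Gamma>, add_mset (All x A) \<Delta>) G)"
proof (rule ccontr)
  assume not: "\<not> ?thesis"
  have I: "interpretation01 L I" using M by (simp add: model01_def)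
  let ?v = "\<lambda>m. truth_val (I\<lparr>bassign := (bassign I)(x := m)\<rparr>) A"
  have "mset_val I \<Gamma> - mset_val I \<Delta> < (SUP m\<in>univ I. ?v m)" using not by simp
  then obtain m where m: "m \<in> univ I" "mset_val I \<Gamma> - mset_val I \<Delta> < ?v m"
    using less_cSUP_iff[of "univ I" ?v] truth_val_instances[OF I formula_quantifier(1)[OF A]] I
    by (auto simp: interpretation01_def)
  let ?J = "I\<lparr>fassign := (fassign I)(a := m)\<rparr>"
  have "true_in ?J (add_mset (\<Gamma>, add_mset (inst x (FVar a) A) \<Delta>) G)"
    using prem model01_fassign[OF M T m(1)] by blast
  moreover have "\<not> true_in ?J G"
    using not a by (subst true_in_fassign_cong) (auto simp: fvars_hypersequent_def)
  moreover have "sequent_val ?J (\<Gamma>, \<Delta>) = sequent_val I (\<Gamma>, \<Delta>)"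
    using a by (intro sequent_val_fassign_cong) (auto simp: fvars_hypersequent_def fvars_sequent_def)
  moreover have "truth_val ?J (inst x (FVar a) A) = ?v m"
    using a by (intro truth_val_eigenvariable) (auto simp: fvars_hypersequent_def fvars_sequent_def)
  ultimately show False using m(2) by simp
qed

lemma ex_left_sound:
  fixes I :: "('f, 'p, 'm) interp"
  assumes M: "model01 L T I" and A: "formula L (Ex x A)" and T: "a \<notin> fvars_theory T"
    and a: "a \<notin> fvars_hypersequent (add_mset (add_mset (Ex x A) \<Gamma>, \<Delta>) G)"
    and prem: "\<And>I :: ('f, 'p, 'm) interp. model01 L T I \<Longrightarrow> true_in I (add_mset (add_mset (inst x (FVar a) A) \<Gamma>, \<Delta>) G)"
  shows "true_in I (add_mset (add_mset (Ex x A) \<Gamma>, \<Delta>) G)"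
proof (rule ccontr)
  assume not: "\<not> ?thesis"
  have I: "interpretation01 L I" using M by (simp add: model01_def)
  let ?v = "\<lambda>m. truth_val (I\<lparr>bassign := (bassign I)(x := m)\<rparr>) A"
  have "(INF m\<in>univ I. ?v m) < mset_val I \<Delta> - mset_val I \<Gamma>" using not by simp
  then obtain m where m: "m \<in> univ I" "?v m < mset_val I \<Delta> - mset_val I \<Gamma>"
    using cINF_less_iff[of "univ I" ?v] truth_val_instances[OF I formula_quantifier(2)[OF A]] I
    by (auto simp: interpretation01_def)
  let ?J = "I\<lparr>fassign := (fassign I)(a := m)\<rparr>"
  have "true_in ?J (add_mset (add_mset (inst x (FVar a) A) \<Gamma>, \<Delta>) G)"
    using prem model01_fassign[OF M T m(1)] by blast
  moreover have "\<not> true_in ?J G"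
    using not a by (subst true_in_fassign_cong) (auto simp: fvars_hypersequent_def)
  moreover have "sequent_val ?J (\<Gamma>, \<Delta>) = sequent_val I (\<Gamma>, \<Delta>)"
    using a by (intro sequent_val_fassign_cong) (auto simp: fvars_hypersequent_def fvars_sequent_def)
  moreover have "truth_val ?J (inst x (FVar a) A) = ?v m"
    using a by (intro truth_val_eigenvariable) (auto simp: fvars_hypersequent_def fvars_sequent_def)
  ultimately show False using m(2) by simp
qed

text \<open>The eigenvariable condition relative to \<open>T\<close> is what keeps the modified interpretations in
\<open>all_right_sound\<close> and \<open>ex_left_sound\<close> models of \<open>T\<close>. For (s-Cut), the values of the two sequents that
are cut add up to 1, so they are not both \<open>\<le> 0\<close>.\<close>

lemma soundness:
  fixes I :: "('f, 'p, 'm) interp"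
  assumes "derivable_from L (GL_sCut L) T H" "model01 L T I"
  shows "true_in I H"
  using assms
proof (induction arbitrary: I rule: derivable_from.induct)
  case (axiom A)
  then show ?case by (simp add: model01_def)
next
  case (step Ps E H)
  have I: "interpretation01 L I" using step.prems by (simp add: model01_def)
  have prems: "true_in J P" if "P \<in> set Ps" "model01 L T J" for P and J :: "('f, 'p, 'm) interp"
    using step.IH that by blast
  have lprems: "lhypersequent L P" if "P \<in> set Ps" for P
    using step.IH that derivable_from_lhypersequent by blast
  have lH: "lhypersequent L H" and E: "E \<inter> fvars_theory T = {}" using step.hyps by auto
  consider "GL L Ps E H" | "sCut Ps E H" using step.hyps by (auto simp: GL_sCut_def)
  then show ?case
  proof cases
    case 1
    then show ?thesis
    proof cases
      case (AllL t x A \<Gamma> \<Delta> G)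
      have "true_in I (add_mset (add_mset (inst x t A) \<Gamma>, \<Delta>) G)"
        using prems[OF _ step.prems] AllL by simp
      moreover have "truth_val I (inst x t A) \<le> truth_val I (All x A)"
        using truth_val_quantifier_instance(1)[OF I] AllL lH by simp
      ultimately show ?thesis unfolding AllL(3) by (auto simp del: truth_val.simps)
    next
      case (ExR t \<Gamma> x A \<Delta> G)
      have "true_in I (add_mset (\<Gamma>, add_mset (inst x t A) \<Delta>) G)"
        using prems[OF _ step.prems] ExR by simp
      moreover have "truth_val I (Ex x A) \<le> truth_val I (inst x t A)"
        using truth_val_quantifier_instance(2)[OF I] ExR lH by simp
      ultimately show ?thesis unfolding ExR(3) by (auto simp del: truth_val.simps)
    next
      case (AllR a \<Gamma> x A \<Delta> G)
      show ?thesis unfolding AllR(3)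
      proof (rule all_right_sound[OF step.prems])
        show "formula L (All x A)" using lH AllR by simp
        show "a \<notin> fvars_theory T" using E AllR by simp
        show "a \<notin> fvars_hypersequent (add_mset (\<Gamma>, add_mset (All x A) \<Delta>) G)" by fact
        show "true_in J (add_mset (\<Gamma>, add_mset (inst x (FVar a) A) \<Delta>) G)" if "model01 L T J" for J :: "('f, 'p, 'm) interp"
          using prems[OF _ that] AllR by simp
      qed
    next
      case (ExL a x A \<Gamma> \<Delta> G)
      show ?thesis unfolding ExL(3)
      proof (rule ex_left_sound[OF step.prems])
        show "formula L (Ex x A)" using lH ExL by simp
        show "a \<notin> fvars_theory T" using E ExL by simp
        show "a \<notin> fvars_hypersequent (add_mset (add_mset (Ex x A) \<Gamma>, \<Delta>) G)" by fact
        show "true_in J (add_mset (add_mset (inst x (FVar a) A) \<Gamma>, \<Delta>) G)" if "model01 L T J" for J :: "('f, 'p, 'm) interp"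
          using prems[OF _ that] ExL by simp
      qed
    next
      case (Bot A)
      then show ?thesis using truth_val_formula[OF I, of A] lH by simp
    next
      case (IW \<Gamma> \<Delta> G A)
      have "true_in I (add_mset (\<Gamma>, \<Delta>) G)" using prems[OF _ step.prems] IW by simp
      then show ?thesis unfolding IW(3) using truth_val_formula(1)[OF I, of A] lH IW by auto
    next
      case (M \<Gamma>1 \<Delta>1 G \<Gamma>2 \<Delta>2)
      have "true_in I (add_mset (\<Gamma>1, \<Delta>1) G)" "true_in I (add_mset (\<Gamma>2, \<Delta>2) G)"
        using prems[OF _ step.prems] M by (simp_all del: true_in_simps)
      then show ?thesis unfolding M(3) by (cases "true_in I G") auto
    next
      case (S \<Gamma>1 \<Gamma>2 \<Delta>1 \<Delta>2 G)
      have "true_in I (add_mset (\<Gamma>1 + \<Gamma>2, \<Delta>1 + \<Delta>2) G)"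
        using prems[OF _ step.prems] S by simp
      then show ?thesis unfolding S(3) by auto
    next
      case (ImpL \<Gamma> \<Delta> B A G)
      have "true_in I (add_mset (\<Gamma>, \<Delta>) (add_mset (add_mset B \<Gamma>, add_mset A \<Delta>) G))"
        using prems[OF _ step.prems] ImpL by simp
      then show ?thesis unfolding ImpL(3) by auto
    next
      case (ImpR \<Gamma> \<Delta> G A B)
      have "true_in I (add_mset (\<Gamma>, \<Delta>) G)"
        "true_in I (add_mset (add_mset A \<Gamma>, add_mset B \<Delta>) G)"
        using prems[OF _ step.prems] ImpR by (simp_all del: true_in_simps)
      then show ?thesis unfolding ImpR(3) by (auto simp: max_def)
    next
      case (EC \<Gamma> \<Delta> G)
      then show ?thesis using prems[OF _ step.prems] by simp
    next
      case (EW G \<Gamma> \<Delta>)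
      then show ?thesis using prems[OF _ step.prems] by simp
    qed auto
  next
    case 2
    then show ?thesis
    proof cases
      case (1 \<Gamma> \<Delta>)
      have "true_in I (add_mset (\<Gamma>, \<Delta>) H)" "true_in I (add_mset (\<Delta>, add_mset Bot \<Gamma>) H)"
        using prems[OF _ step.prems] 1 by (simp_all del: true_in_simps)
      then show ?thesis by auto
    qed
  qed
qed

section \<open>Derived structural inferences\<close>

text \<open>The structural inferences are used both in the cut-free calculus and in the calculus with
(s-Cut) over a theory.\<close>

locale extends_GL =
  fixes L :: "('f, 'p) language" and C :: "('f, 'p) calculus" and T :: "('f, 'p) semiformula set"
  assumes GL_imp: "GL L Ps E G \<Longrightarrow> C Ps E G"
    and conclusion_nonempty: "C Ps E G \<Longrightarrow> G \<noteq> {#}"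
begin

abbreviation D :: "('f, 'p) hypersequent \<Rightarrow> bool" where
  "D \<equiv> derivable_from L C T"

lemma infer: "GL L Ps {} G \<Longrightarrow> lhypersequent L G \<Longrightarrow> (\<And>P. P \<in> set Ps \<Longrightarrow> D P) \<Longrightarrow> D G"
  by (rule derivable_from.step[OF GL_imp]) auto

lemma lhyp: "D G \<Longrightarrow> lhypersequent L G"
  by (rule derivable_from_lhypersequent)

lemma axiom_id: "formula L A \<Longrightarrow> D {#({#A#}, {#A#})#}"
  by (rule infer[OF GL.ID]) simp_all

lemma axiom_empty: "D {#({#}, {#})#}"
  by (rule infer[OF GL.EMP]) simp_all

lemma axiom_bot: "formula L A \<Longrightarrow> D {#({#Bot#}, {#A#})#}"
  by (rule infer[OF GL.Bot]) simp_all

lemma nonempty: "D G \<Longrightarrow> G \<noteq> {#}"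
  by (erule derivable_from.cases) (auto simp: of_formula_def dest: conclusion_nonempty)

lemma ext_weakening: "D G \<Longrightarrow> lhypersequent L H \<Longrightarrow> D (H + G)"
proof (induction H)
  case (add S H)
  then have D: "D (H + G)" by simp
  have "GL L [H + G] {} (add_mset S (H + G))"
    using GL.EW[OF nonempty[OF D], of L "fst S" "snd S"] by simp
  from infer[OF this] show ?case
    using D lhyp[OF D] add.prems by simp
qed simp

lemma ext_contraction:
  assumes "D (add_mset S G)" "S \<in># G"
  shows "D G"
proof -
  have "GL L [add_mset S G] {} G"
    using GL.EC[of L "fst S" "snd S" "G - {#S#}"] assms(2) by simp
  from infer[OF this] show ?thesis
    using assms(1) lhyp[OF assms(1)] by simp
qed

text \<open>(EW) and (EC) together make derivability depend only on the set of components, and make it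
monotone in this set.\<close>

lemma derivable_support:
  assumes "D X" "set_mset X \<subseteq> set_mset Y" "lhypersequent L Y"
  shows "D Y"
proof -
  have "D (X + Y) \<Longrightarrow> set_mset X \<subseteq> set_mset Y \<Longrightarrow> D Y" for X
    by (induction X) (auto dest: ext_contraction)
  moreover have "D (X + Y)" using ext_weakening[OF assms(1,3)] by (simp add: add.commute)
  ultimately show ?thesis using assms(2) by blast
qed

lemma int_weakening:
  assumes "D (add_mset (\<Gamma>, \<Delta>) G)" "formula L A"
  shows "D (add_mset (add_mset A \<Gamma>, \<Delta>) G)"
  by (rule infer[OF GL.IW]) (use assms lhyp[OF assms(1)] in simp_all)

lemma mix:
  assumes "D (add_mset S G)" "D (add_mset S' G)"
  shows "D (add_mset (S + S') G)"
proof -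
  have "GL L [add_mset S G, add_mset S' G] {} (add_mset (S + S') G)"
    using GL.M[of L "fst S" "snd S" G "fst S'" "snd S'"] by (simp add: plus_prod_def)
  from infer[OF this] show ?thesis
    using assms lhyp[OF assms(1)] lhyp[OF assms(2)] by auto
qed

lemma split:
  assumes "D (add_mset (S + S') G)"
  shows "D (add_mset S (add_mset S' G))"
proof -
  have "GL L [add_mset (S + S') G] {} (add_mset S (add_mset S' G))"
    using GL.S[of L "fst S" "fst S'" "snd S" "snd S'" G] by (simp add: plus_prod_def)
  from infer[OF this] show ?thesis
    using assms lhyp[OF assms(1)] by auto
qed

text \<open>Repeated use of (S): a hypersequent is derivable as soon as the sum of its components is. This is
how arithmetic facts about sums of sequents become derivations.\<close>

lemma split_sum: "D (add_mset (\<Sum>\<^sub># Y) X) \<Longrightarrow> Y \<noteq> {#} \<Longrightarrow> D (Y + X)"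
proof (induction Y arbitrary: X)
  case (add S Y)
  show ?case
  proof (cases "Y = {#}")
    case False
    have "D (add_mset (\<Sum>\<^sub># Y) (add_mset S X))"
      using split[of S "\<Sum>\<^sub># Y" X] add.prems by (simp add: add_mset_commute)
    then show ?thesis using add.IH[of "add_mset S X"] False by simp
  qed (use add in simp)
qed simp

text \<open>After weakening by one \<open>\<bottom>\<close>, the sequent \<open>\<bottom>, 2\<Gamma> \<Rightarrow> 2\<Delta>\<close> is the sum of two copies of
\<open>\<bottom>, \<Gamma> \<Rightarrow> \<Delta>\<close>.\<close>

lemma approx_1_of_2:
  assumes "D (approx 2 G)"
  shows "D (approx 1 G)"
proof -
  have "D (add_mset (approx_sequent 2 S) X) \<Longrightarrow> D (add_mset (approx_sequent 1 S) X)" for S X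
  proof -
    let ?S = "approx_sequent 1 S"
    assume "D (add_mset (approx_sequent 2 S) X)"
    then have "D (add_mset (add_mset Bot (fst (approx_sequent 2 S)), snd (approx_sequent 2 S)) X)"
      by (intro int_weakening) simp_all
    also have "(add_mset Bot (fst (approx_sequent 2 S)), snd (approx_sequent 2 S)) = ?S + ?S"
      by (simp add: approx_sequent_def numeral_2_eq_2)
    finally have "D (add_mset ?S (add_mset ?S X))" by (rule split)
    then show "D (add_mset ?S X)" by (rule ext_contraction) simp
  qed
  then have "D (approx 2 G + X) \<Longrightarrow> D (approx 1 G + X)" for X
  proof (induction G arbitrary: X)
    case (add S G)
    then have "D (add_mset (approx_sequent 1 S) (approx 2 G + X))"
      by (simp add: approx_def)
    then show ?case using add.IH[of "add_mset (approx_sequent 1 S) X"] add.prems(2)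
      by (simp add: approx_def)
  qed (simp add: approx_def)
  then show ?thesis using assms by (metis add_0_right)
qed

end

lemma GL_conclusion_nonempty: "GL L Ps E G \<Longrightarrow> G \<noteq> {#}"
  by (erule GL.cases) auto

interpretation GL: extends_GL L "GL L" T for L T
  by unfold_locales (auto dest: GL_conclusion_nonempty)

interpretation GLcut: extends_GL L "GL_sCut L" T for L T
  by unfold_locales (auto simp: GL_sCut_def dest: GL_conclusion_nonempty elim: sCut.cases)

lemma derivable_from_calculus_mono:
  assumes "derivable_from L C T G" "\<And>Ps E G. C Ps E G \<Longrightarrow> C' Ps E G"
  shows "derivable_from L C' T G"
  using assms(1) by induction (auto intro: derivable_from.intros assms(2))

section \<open>Cutting away formulas of the theory\<close>

lemma theory_formula_copies:
  assumes "C \<in> T" "ltheory L T"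
  shows "derivable_from L (GL_sCut L) T {#({#}, replicate_mset k C)#}"
proof (induction k)
  case 0
  show ?case using GLcut.axiom_empty by simp
next
  case (Suc k)
  have "derivable_from L (GL_sCut L) T {#({#}, {#C#})#}"
    using derivable_from.axiom[of C T L] assms
    by (auto simp: of_formula_def ltheory_def)
  from GLcut.mix[OF this Suc] show ?case by simp
qed

text \<open>The cut partner of \<open>\<bottom>, nmC \<Rightarrow> n\<bottom>\<close> is \<open>(n-1)\<bottom> \<Rightarrow> \<bottom>, nmC\<close>. It follows from \<open>\<bottom> \<Rightarrow> \<bottom>\<close> and
\<open>\<Rightarrow> nmC\<close> by (M) and weakening, provided that at least one \<open>\<bottom>\<close> is on the left, that is, \<open>n \<ge> 2\<close>.\<close>

lemma cut_theory_formula: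
  assumes C: "C \<in> T" "ltheory L T" and n: "n \<ge> 2" and X: "X \<noteq> {#}"
    and D: "derivable_from L (GL_sCut L) T (add_mset (approx_sequent n (replicate_mset m C, {#Bot#})) X)"
  shows "derivable_from L (GL_sCut L) T X"
proof -
  let ?\<Delta> = "add_mset Bot (replicate_mset (n * m) C)"
  have lX: "lhypersequent L X" using GLcut.lhyp[OF D] by simp
  have "derivable_from L (GL_sCut L) T {#({#Bot#}, {#Bot#})#}"
    by (rule GLcut.axiom_id) simp
  from GLcut.mix[OF this theory_formula_copies[OF C]]
  have "derivable_from L (GL_sCut L) T {#({#Bot#}, ?\<Delta>)#}"
    by simp
  then have "derivable_from L (GL_sCut L) T {#(replicate_mset (Suc k) Bot, ?\<Delta>)#}" for k
    by (induction k) (auto intro: GLcut.int_weakening)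
  (* n - 2 further copies of Bot, on top of the one from the axiom *)
  from this[of "n - 2"]
  have "derivable_from L (GL_sCut L) T {#(replicate_mset (n - 1) Bot, ?\<Delta>)#}"
    using n by (simp add: Suc_diff_Suc numeral_2_eq_2)
  from GLcut.ext_weakening[OF this lX]
  have 1: "derivable_from L (GL_sCut L) T (add_mset (replicate_mset (n - 1) Bot, ?\<Delta>) X)"
    by simp
  have "approx_sequent n (replicate_mset m C, {#Bot#})
      = (?\<Delta>, add_mset Bot (replicate_mset (n - 1) Bot))"
    using n by (cases n) (auto simp: approx_sequent_def multiset_eq_iff)
  then have 2: "derivable_from L (GL_sCut L) T (add_mset (?\<Delta>, add_mset Bot (replicate_mset (n - 1) Bot)) X)"
    using D by simp
  show ?thesis
    by (rule derivable_from.step[of _ "[add_mset (replicate_mset (n - 1) Bot, ?\<Delta>) X,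
          add_mset (?\<Delta>, add_mset Bot (replicate_mset (n - 1) Bot)) X]" "{}"])
      (use 1 2 lX X in \<open>auto simp: GL_sCut_def intro: sCut.intros\<close>)
qed

section \<open>Renaming the free variables of a derivation\<close>

lemma ren_sequent_fresh: "a \<notin> fvars_sequent S \<Longrightarrow> ren_sequent (\<rho>(a := b)) S = ren_sequent \<rho> S"
  by (rule ren_sequent_cong) auto

lemma ren_fresh: "a \<notin> fvars A \<Longrightarrow> ren (\<rho>(a := b)) A = ren \<rho> A"
  by (rule ren_cong) auto

lemma lhypersequent_ren: "lhypersequent L H \<Longrightarrow> lhypersequent L (image_mset (ren_sequent \<rho>) H)"
  by (auto simp: lhypersequent_def lsequent_ren)

text \<open>The renaming need not be injective, because the eigenvariables are chosen anew at each inference.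
The lemma serves two purposes: with a set \<open>T\<close> it moves the eigenvariables away from the variables of
\<open>T\<close>, and with \<open>T = {}\<close> it undoes the renaming that provides fresh variables in the completeness
proof.\<close>

lemma derivable_ren:
  assumes "derivable L (GL L) H" and inf: "infinite (- fvars_theory T)"
  shows "derivable_from L (GL L) T (image_mset (ren_sequent \<rho>) H)"
  using assms(1)
proof (induction arbitrary: \<rho> rule: derivable_from.induct)
  case (axiom A)
  then show ?case by simp
next
  case (step Ps E H)
  let ?R = "\<lambda>\<rho>. image_mset (ren_sequent \<rho>)"
  let ?D = "derivable_from L (GL L) T"
  have IH: "?D (?R \<rho> P)" if "P \<in> set Ps" for P \<rho> using step.IH that by blast
  have lH: "lhypersequent L (?R \<rho> H)" using step.hyps lhypersequent_ren by blast
  have IHs: "?D P" if "P \<in> set (map (?R \<rho>) Ps)" for P using IH that by auto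
  have fresh: "\<exists>b. b \<notin> fvars_theory T \<and> b \<notin> fvars_hypersequent G" for G :: "('f, 'p) hypersequent"
  proof -
    have "infinite (- fvars_theory T - fvars_hypersequent G)"
      using inf finite_fvars_hypersequent by (rule Diff_infinite_finite[rotated])
    from infinite_imp_nonempty[OF this] show ?thesis by blast
  qed
  from step.hyps(1) show ?case
  proof cases
    case ID
    then have "GL L (map (?R \<rho>) Ps) {} (?R \<rho> H)" by (simp add: GL.ID)
    from GL.infer[OF this lH IHs] show ?thesis .
  next
    case EMP
    then have "GL L (map (?R \<rho>) Ps) {} (?R \<rho> H)" by (simp add: GL.EMP)
    from GL.infer[OF this lH IHs] show ?thesis .
  next
    case Bot
    then have "GL L (map (?R \<rho>) Ps) {} (?R \<rho> H)" by (simp add: GL.Bot)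
    from GL.infer[OF this lH IHs] show ?thesis .
  next
    case EW
    then have "GL L (map (?R \<rho>) Ps) {} (?R \<rho> H)" by (simp add: GL.EW)
    from GL.infer[OF this lH IHs] show ?thesis .
  next
    case EC
    then have "GL L (map (?R \<rho>) Ps) {} (?R \<rho> H)" by (simp add: GL.EC)
    from GL.infer[OF this lH IHs] show ?thesis .
  next
    case IW
    then have "GL L (map (?R \<rho>) Ps) {} (?R \<rho> H)" by (simp add: GL.IW)
    from GL.infer[OF this lH IHs] show ?thesis .
  next
    case S
    then have "GL L (map (?R \<rho>) Ps) {} (?R \<rho> H)" by (simp add: GL.S)
    from GL.infer[OF this lH IHs] show ?thesis .
  next
    case M
    then have "GL L (map (?R \<rho>) Ps) {} (?R \<rho> H)" by (simp add: GL.M)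
    from GL.infer[OF this lH IHs] show ?thesis .
  next
    case ImpL
    then have "GL L (map (?R \<rho>) Ps) {} (?R \<rho> H)" by (simp add: GL.ImpL)
    from GL.infer[OF this lH IHs] show ?thesis .
  next
    case ImpR
    then have "GL L (map (?R \<rho>) Ps) {} (?R \<rho> H)" by (simp add: GL.ImpR)
    from GL.infer[OF this lH IHs] show ?thesis .
  next
    case AllL
    then have "GL L (map (?R \<rho>) Ps) {} (?R \<rho> H)" by (simp add: GL.AllL lterm_ren ren_inst)
    from GL.infer[OF this lH IHs] show ?thesis .
  next
    case ExR
    then have "GL L (map (?R \<rho>) Ps) {} (?R \<rho> H)" by (simp add: GL.ExR lterm_ren ren_inst)
    from GL.infer[OF this lH IHs] show ?thesis .
  next
    case (AllR a \<Gamma> x A \<Delta> G)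
    obtain b where b: "b \<notin> fvars_theory T" "b \<notin> fvars_hypersequent (?R \<rho> H)"
      using fresh by blast
    let ?\<rho> = "\<rho>(a := b)"
    have "?R ?\<rho> H = ?R \<rho> H"
      using AllR by (intro image_mset_cong ren_sequent_fresh) (auto simp: fvars_hypersequent_def)
    then have same: "image_mset (ren ?\<rho>) \<Gamma> = image_mset (ren \<rho>) \<Gamma>" "ren ?\<rho> A = ren \<rho> A"
        "image_mset (ren ?\<rho>) \<Delta> = image_mset (ren \<rho>) \<Delta>" "?R ?\<rho> G = ?R \<rho> G"
      using AllR
      by (auto intro!: image_mset_cong ren_sequent_fresh ren_fresh simp: fvars_hypersequent_def fvars_sequent_def)
    have "?D (?R ?\<rho> (add_mset (\<Gamma>, add_mset (inst x (FVar a) A) \<Delta>) G))"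
      using IH AllR by (simp del: image_mset_add_mset)
    then have "?D (add_mset (image_mset (ren \<rho>) \<Gamma>,
        add_mset (inst x (FVar b) (ren \<rho> A)) (image_mset (ren \<rho>) \<Delta>)) (?R \<rho> G))"
      by (simp add: ren_inst same)
    then show ?thesis
      using GL.AllR[of b "image_mset (ren \<rho>) \<Gamma>" x "ren \<rho> A" "image_mset (ren \<rho>) \<Delta>" "?R \<rho> G" L] b lH AllR
      by (intro derivable_from.step[of "GL L" _ "{b}"]) auto
  next
    case (ExL a x A \<Gamma> \<Delta> G)
    obtain b where b: "b \<notin> fvars_theory T" "b \<notin> fvars_hypersequent (?R \<rho> H)"
      using fresh by blast
    let ?\<rho> = "\<rho>(a := b)"
    have same: "image_mset (ren ?\<rho>) \<Gamma> = image_mset (ren \<rho>) \<Gamma>" "ren ?\<rho> A = ren \<rho> A"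
        "image_mset (ren ?\<rho>) \<Delta> = image_mset (ren \<rho>) \<Delta>" "?R ?\<rho> G = ?R \<rho> G"
      using ExL
      by (auto intro!: image_mset_cong ren_sequent_fresh ren_fresh simp: fvars_hypersequent_def fvars_sequent_def)
    have "?D (?R ?\<rho> (add_mset (add_mset (inst x (FVar a) A) \<Gamma>, \<Delta>) G))"
      using IH ExL by (simp del: image_mset_add_mset)
    then have "?D (add_mset (add_mset (inst x (FVar b) (ren \<rho> A)) (image_mset (ren \<rho>) \<Gamma>),
        image_mset (ren \<rho>) \<Delta>) (?R \<rho> G))"
      by (simp add: ren_inst same)
    then show ?thesis
      using GL.ExL[of b x "ren \<rho> A" "image_mset (ren \<rho>) \<Gamma>" "image_mset (ren \<rho>) \<Delta>" "?R \<rho> G" L] b lH ExL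
      by (intro derivable_from.step[of "GL L" _ "{b}"]) auto
  qed
qed

section \<open>Consistent sets of sequents\<close>

text \<open>By \<open>derivable_support\<close> it does not matter that the hypersequent \<open>X\<close> may repeat components.
A consistent set is a candidate for a set of sequents that are simultaneously not true.\<close>

definition inconsistent :: "('f, 'p) language \<Rightarrow> ('f, 'p) sequent set \<Rightarrow> bool" where
  "inconsistent L H \<longleftrightarrow> (\<exists>X. set_mset X \<subseteq> H \<and> derivable L (GL L) X)"

lemma inconsistent_mono: "inconsistent L H \<Longrightarrow> H \<subseteq> H' \<Longrightarrow> inconsistent L H'"
  by (auto simp: inconsistent_def)

lemma inconsistent_insertE:
  assumes "inconsistent L (insert S H)" "lsequent L S"
  obtains X where "set_mset X \<subseteq> H" "derivable L (GL L) (add_mset S X)"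
proof -
  obtain X where X: "set_mset X \<subseteq> insert S H" "derivable L (GL L) X"
    using assms(1) by (auto simp: inconsistent_def)
  let ?X = "filter_mset (\<lambda>R. R \<in> H) X"
  have "derivable L (GL L) (add_mset S ?X)"
    using X assms(2) GL.lhyp[OF X(2)]
    by (intro GL.derivable_support[OF X(2)]) (auto simp: lhypersequent_def)
  then show thesis by (intro that[of ?X]) auto
qed

lemma inconsistent_if_rule:
  assumes "inconsistent L (insert P H)" "lsequent L P" "S \<in> H"
    and rule: "\<And>X. derivable L (GL L) (add_mset P X) \<Longrightarrow> derivable L (GL L) (add_mset S X)"
  shows "inconsistent L H"
proof -
  obtain X where X: "set_mset X \<subseteq> H" "derivable L (GL L) (add_mset P X)"
    using inconsistent_insertE[OF assms(1,2)] .
  have "set_mset (add_mset S X) \<subseteq> H" using X(1) assms(3) by simp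
  with rule[OF X(2)] show ?thesis unfolding inconsistent_def by blast
qed

text \<open>The principal sequent can be kept next to the premise, since (EC) removes the duplicate. Hence a
fresh variable is a harmless witness for the failure of a universal formula.\<close>

lemma all_right_consistent:
  assumes H: "\<not> inconsistent L H" "\<forall>S\<in>H. lsequent L S" and S: "(\<Gamma>, add_mset (All x A) \<Delta>) \<in> H"
    and a: "\<forall>S\<in>H. a \<notin> fvars_sequent S"
  shows "\<not> inconsistent L (insert (\<Gamma>, add_mset (inst x (FVar a) A) \<Delta>) H)"
proof
  let ?P = "(\<Gamma>, add_mset (inst x (FVar a) A) \<Delta>)" and ?S = "(\<Gamma>, add_mset (All x A) \<Delta>)"
  assume inc: "inconsistent L (insert ?P H)"
  have lS: "lsequent L ?S" using S H(2) by blast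
  then have "lsequent L ?P" by (auto intro: formula_inst lterm.intros)
  then obtain X where X: "set_mset X \<subseteq> H" "derivable L (GL L) (add_mset ?P X)"
    using inconsistent_insertE[OF inc] by blast
  have "a \<notin> fvars_hypersequent (add_mset ?S X)"
    using X(1) a S by (auto simp: fvars_hypersequent_def)
  from derivable_from.step[of "GL L", OF GL.AllR[OF this]]
  have "derivable L (GL L) (add_mset ?S X)"
    using X(2) lS GL.lhyp[OF X(2)] by (simp add: fvars_theory_def)
  moreover have "set_mset (add_mset ?S X) \<subseteq> H" using X(1) S by simp
  ultimately show False using H(1) unfolding inconsistent_def by blast
qed

lemma ex_left_consistent:
  assumes H: "\<not> inconsistent L H" "\<forall>S\<in>H. lsequent L S" and S: "(add_mset (Ex x A) \<Gamma>, \<Delta>) \<in> H"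
    and a: "\<forall>S\<in>H. a \<notin> fvars_sequent S"
  shows "\<not> inconsistent L (insert (add_mset (inst x (FVar a) A) \<Gamma>, \<Delta>) H)"
proof
  let ?P = "(add_mset (inst x (FVar a) A) \<Gamma>, \<Delta>)" and ?S = "(add_mset (Ex x A) \<Gamma>, \<Delta>)"
  assume inc: "inconsistent L (insert ?P H)"
  have lS: "lsequent L ?S" using S H(2) by blast
  then have "lsequent L ?P" by (auto intro: formula_inst lterm.intros)
  then obtain X where X: "set_mset X \<subseteq> H" "derivable L (GL L) (add_mset ?P X)"
    using inconsistent_insertE[OF inc] by blast
  have "a \<notin> fvars_hypersequent (add_mset ?S X)"
    using X(1) a S by (auto simp: fvars_hypersequent_def)
  from derivable_from.step[of "GL L", OF GL.ExL[OF this]]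
  have "derivable L (GL L) (add_mset ?S X)"
    using X(2) lS GL.lhyp[OF X(2)] by (simp add: fvars_theory_def)
  moreover have "set_mset (add_mset ?S X) \<subseteq> H" using X(1) S by simp
  ultimately show False using H(1) unfolding inconsistent_def by blast
qed

definition max_consistent :: "('f, 'p) language \<Rightarrow> ('f, 'p) sequent set \<Rightarrow> bool" where
  "max_consistent L H \<longleftrightarrow> (\<forall>S\<in>H. lsequent L S) \<and> \<not> inconsistent L H \<and>
     (\<forall>S. lsequent L S \<longrightarrow> \<not> inconsistent L (insert S H) \<longrightarrow> S \<in> H)"

text \<open>Logical rules are read upwards: a premise that could not be added would make the conclusion, which
is already there, inconsistent as well.\<close>

lemma max_consistent_rule:
  assumes H: "max_consistent L H" and "S \<in> H" "lsequent L P"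
    and "\<And>X. derivable L (GL L) (add_mset P X) \<Longrightarrow> derivable L (GL L) (add_mset S X)"
  shows "P \<in> H"
  using assms inconsistent_if_rule[of L P H S] unfolding max_consistent_def by blast

lemma max_consistent_lsequent: "max_consistent L H \<Longrightarrow> S \<in> H \<Longrightarrow> lsequent L S"
  by (simp add: max_consistent_def)

lemma max_consistent_all_left:
  assumes H: "max_consistent L H" and S: "(add_mset (All x A) \<Gamma>, \<Delta>) \<in> H" and t: "lterm L t"
  shows "(add_mset (inst x t A) \<Gamma>, \<Delta>) \<in> H"
proof (rule max_consistent_rule[OF H S])
  have lS: "formula L (All x A)" "lsequent L (\<Gamma>, \<Delta>)" using max_consistent_lsequent[OF H S] by auto
  then show "lsequent L (add_mset (inst x t A) \<Gamma>, \<Delta>)" using t by (simp add: formula_inst)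
  fix X assume P: "derivable L (GL L) (add_mset (add_mset (inst x t A) \<Gamma>, \<Delta>) X)"
  show "derivable L (GL L) (add_mset (add_mset (All x A) \<Gamma>, \<Delta>) X)"
    by (rule GL.infer[OF GL.AllL[OF t]]) (use P lS GL.lhyp[OF P] in simp_all)
qed

lemma max_consistent_ex_right:
  assumes H: "max_consistent L H" and S: "(\<Gamma>, add_mset (Ex x A) \<Delta>) \<in> H" and t: "lterm L t"
  shows "(\<Gamma>, add_mset (inst x t A) \<Delta>) \<in> H"
proof (rule max_consistent_rule[OF H S])
  have lS: "formula L (Ex x A)" "lsequent L (\<Gamma>, \<Delta>)" using max_consistent_lsequent[OF H S] by auto
  then show "lsequent L (\<Gamma>, add_mset (inst x t A) \<Delta>)" using t by (simp add: formula_inst)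
  fix X assume P: "derivable L (GL L) (add_mset (\<Gamma>, add_mset (inst x t A) \<Delta>) X)"
  show "derivable L (GL L) (add_mset (\<Gamma>, add_mset (Ex x A) \<Delta>) X)"
    by (rule GL.infer[OF GL.ExR[OF t]]) (use P lS GL.lhyp[OF P] in simp_all)
qed

lemma max_consistent_imp_left:
  assumes H: "max_consistent L H" and S: "(add_mset (Imp A B) \<Gamma>, \<Delta>) \<in> H"
  shows "(\<Gamma>, \<Delta>) \<in> H" "(add_mset B \<Gamma>, add_mset A \<Delta>) \<in> H"
proof -
  have lS: "formula L A" "formula L B" "lsequent L (\<Gamma>, \<Delta>)"
    using max_consistent_lsequent[OF H S] by auto
  have rule: "derivable L (GL L) (add_mset (add_mset (Imp A B) \<Gamma>, \<Delta>) X)"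
    if P: "derivable L (GL L) (add_mset (\<Gamma>, \<Delta>) (add_mset (add_mset B \<Gamma>, add_mset A \<Delta>) X))" for X
    by (rule GL.infer[OF GL.ImpL]) (use P lS GL.lhyp[OF P] in simp_all)
  show "(\<Gamma>, \<Delta>) \<in> H"
  proof (rule max_consistent_rule[OF H S lS(3)])
    fix X assume P: "derivable L (GL L) (add_mset (\<Gamma>, \<Delta>) X)"
    show "derivable L (GL L) (add_mset (add_mset (Imp A B) \<Gamma>, \<Delta>) X)"
      by (rule rule, rule GL.derivable_support[OF P]) (use lS GL.lhyp[OF P] in auto)
  qed
  show "(add_mset B \<Gamma>, add_mset A \<Delta>) \<in> H"
  proof (rule max_consistent_rule[OF H S])
    show "lsequent L (add_mset B \<Gamma>, add_mset A \<Delta>)" using lS by simp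
    fix X assume P: "derivable L (GL L) (add_mset (add_mset B \<Gamma>, add_mset A \<Delta>) X)"
    show "derivable L (GL L) (add_mset (add_mset (Imp A B) \<Gamma>, \<Delta>) X)"
      by (rule rule, rule GL.derivable_support[OF P]) (use lS GL.lhyp[OF P] in auto)
  qed
qed

text \<open>The two premises of the rule are refuted by different hypersequents \<open>X\<close> and \<open>Y\<close>; both are needed
as side hypersequent of the common inference.\<close>

lemma max_consistent_imp_right:
  assumes H: "max_consistent L H" and S: "(\<Gamma>, add_mset (Imp A B) \<Delta>) \<in> H"
  shows "(\<Gamma>, \<Delta>) \<in> H \<or> (add_mset A \<Gamma>, add_mset B \<Delta>) \<in> H"
proof (rule ccontr)
  let ?P = "(\<Gamma>, \<Delta>)" and ?Q = "(add_mset A \<Gamma>, add_mset B \<Delta>)" and ?S = "(\<Gamma>, add_mset (Imp A B) \<Delta>)"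
  assume "\<not> ?thesis"
  moreover have lS: "lsequent L ?P" "lsequent L ?Q" "lsequent L ?S"
    using max_consistent_lsequent[OF H S] by auto
  ultimately have "inconsistent L (insert ?P H)" "inconsistent L (insert ?Q H)"
    using H unfolding max_consistent_def by blast+
  then obtain X Y where X: "set_mset X \<subseteq> H" "derivable L (GL L) (add_mset ?P X)"
    and Y: "set_mset Y \<subseteq> H" "derivable L (GL L) (add_mset ?Q Y)"
    using inconsistent_insertE lS(1,2) by meson
  have l: "lhypersequent L X" "lhypersequent L Y" using GL.lhyp X(2) Y(2) by fastforce+
  have "derivable L (GL L) (add_mset ?P (X + Y))"
    by (rule GL.derivable_support[OF X(2)]) (use l lS in auto)
  moreover have "derivable L (GL L) (add_mset ?Q (X + Y))"
    by (rule GL.derivable_support[OF Y(2)]) (use l lS in auto)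
  ultimately have "derivable L (GL L) (add_mset ?S (X + Y))"
    by (intro GL.infer[OF GL.ImpR]) (use lS l in auto)
  moreover have "set_mset (add_mset ?S (X + Y)) \<subseteq> H" using X Y S by simp
  ultimately show False using H unfolding max_consistent_def inconsistent_def by blast
qed

section \<open>Countability\<close>

instance semiterm :: (countable) countable
  by countable_datatype

instance semiformula :: (countable, countable) countable
  by countable_datatype

lemma wf_term_symbols: "wf_term L V t \<Longrightarrow> set_semiterm t \<subseteq> funs L"
  by (induction t) auto

lemma wf_formula_symbols:
  "wf_formula L V A \<Longrightarrow> set1_semiformula A \<subseteq> funs L \<and> set2_semiformula A \<subseteq> preds L"
proof (induction A arbitrary: V)
  case (Imp A B)
  from Imp.IH[of V] Imp.prems show ?case by simp
qed (auto dest: wf_term_symbols)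

text \<open>The types of symbols may be uncountable. Numbering the countably many symbols of the language embeds
its formulas into the countable type of expressions over natural numbers.\<close>

lemma countable_formulas:
  assumes "countable_language L"
  shows "countable {A. formula L A}"
proof (rule countableI')
  let ?h = "map_semiformula (to_nat_on (funs L)) (to_nat_on (preds L))"
  have inj: "inj_on (to_nat_on (funs L)) (funs L)" "inj_on (to_nat_on (preds L)) (preds L)"
    using assms by (auto simp: countable_language_def)
  have "inj_on ?h {A. formula L A}"
  proof (rule inj_onI)
    fix A B assume "A \<in> {A. formula L A}" "B \<in> {A. formula L A}" "?h A = ?h B"
    then show "A = B"
      using wf_formula_symbols[of L "{}" A] wf_formula_symbols[of L "{}" B] inj
      by (elim semiformula.inj_map_strong[rotated 2])
        (auto simp: formula_iff_wf_formula dest: inj_onD)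
  qed
  then show "inj_on (to_nat \<circ> ?h) {A. formula L A}"
    by (intro comp_inj_on) (auto intro: inj_on_subset[OF inj_to_nat])
qed

lemma countable_lterms:
  assumes "countable_language L"
  shows "countable {t. lterm L t}"
proof (rule countableI')
  let ?h = "map_semiterm (to_nat_on (funs L))"
  have inj: "inj_on (to_nat_on (funs L)) (funs L)"
    using assms by (auto simp: countable_language_def)
  have "inj_on ?h {t. lterm L t}"
  proof (rule inj_onI)
    fix s t assume "s \<in> {t. lterm L t}" "t \<in> {t. lterm L t}" "?h s = ?h t"
    then show "s = t"
      using wf_term_symbols[of L "{}" s] wf_term_symbols[of L "{}" t] inj
      by (elim semiterm.inj_map_strong[rotated 1]) (auto simp: lterm_iff_wf_term dest: inj_onD)
  qed
  then show "inj_on (to_nat \<circ> ?h) {t. lterm L t}"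
    by (intro comp_inj_on) (auto intro: inj_on_subset[OF inj_to_nat])
qed

lemma countable_lsequents:
  assumes "countable_language L"
  shows "countable {S. lsequent L S}"
proof -
  let ?M = "mset ` lists {A. formula L A}"
  have "countable (?M \<times> ?M)"
    using countable_formulas[OF assms] by (intro countable_SIGMA countable_image countable_lists)
  moreover have "{S. lsequent L S} \<subseteq> ?M \<times> ?M"
  proof
    fix S assume S: "S \<in> {S. lsequent L S}"
    obtain \<Gamma> \<Delta> where "fst S = mset \<Gamma>" "snd S = mset \<Delta>" by (metis ex_mset)
    with S show "S \<in> ?M \<times> ?M" by (cases S) (auto simp: lsequent_def)
  qed
  ultimately show ?thesis by (rule countable_subset[rotated])
qed

section \<open>Extension to a maximal consistent set with witnesses\<close>

text \<open>The requirement attached to a sequent and one of its formulas: if this set is nonempty, one of its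
elements has to be added.\<close>

fun witnesses ::
    "('f, 'p) sequent \<times> ('f, 'p) semiformula \<Rightarrow> ('f, 'p) sequent set" where
  "witnesses ((\<Gamma>, \<Delta>), All x A) =
     (if All x A \<in># \<Delta> then range (\<lambda>a. (\<Gamma>, add_mset (inst x (FVar a) A) (\<Delta> - {#All x A#}))) else {})"
| "witnesses ((\<Gamma>, \<Delta>), Ex x A) =
     (if Ex x A \<in># \<Gamma> then range (\<lambda>a. (add_mset (inst x (FVar a) A) (\<Gamma> - {#Ex x A#}), \<Delta>)) else {})"
| "witnesses _ = {}"

lemma witness_consistent:
  assumes H: "\<not> inconsistent L H" "\<forall>S\<in>H. lsequent L S" and S: "S \<in> H" and W: "witnesses (S, F) \<noteq> {}"
    and inf: "infinite (- (\<Union>S\<in>H. fvars_sequent S))"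
  shows "\<exists>P\<in>witnesses (S, F). lsequent L P \<and> \<not> inconsistent L (insert P H)"
proof -
  obtain a where a: "\<forall>S\<in>H. a \<notin> fvars_sequent S"
    using infinite_imp_nonempty[OF inf] by auto
  obtain \<Gamma> \<Delta> where [simp]: "S = (\<Gamma>, \<Delta>)" by (cases S)
  have lS: "lsequent L (\<Gamma>, \<Delta>)" using H S by auto
  have var: "lterm L (FVar a)" by (rule lterm.intros)
  show ?thesis
  proof (cases F)
    case (All x A)
    then have "All x A \<in># \<Delta>" using W by (simp split: if_splits)
    then obtain \<Delta>' where \<Delta>: "\<Delta> = add_mset (All x A) \<Delta>'" by (metis mset_add)
    have "\<not> inconsistent L (insert (\<Gamma>, add_mset (inst x (FVar a) A) \<Delta>') H)"
      using all_right_consistent[OF H _ a] S \<Delta> by simp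
    moreover have "lsequent L (\<Gamma>, add_mset (inst x (FVar a) A) \<Delta>')"
      using lS \<Delta> formula_inst(1)[OF _ var] by simp
    ultimately show ?thesis using \<Delta> All by auto
  next
    case (Ex x A)
    then have "Ex x A \<in># \<Gamma>" using W by (simp split: if_splits)
    then obtain \<Gamma>' where \<Gamma>: "\<Gamma> = add_mset (Ex x A) \<Gamma>'" by (metis mset_add)
    have "\<not> inconsistent L (insert (add_mset (inst x (FVar a) A) \<Gamma>', \<Delta>) H)"
      using ex_left_consistent[OF H _ a] S \<Gamma> by simp
    moreover have "lsequent L (add_mset (inst x (FVar a) A) \<Gamma>', \<Delta>)"
      using lS \<Gamma> formula_inst(2)[OF _ var] by simp
    ultimately show ?thesis using \<Gamma> Ex by auto
  qed (use W in auto)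
qed

lemma inconsistent_chain:
  assumes "inconsistent L (\<Union>n. f n)" "\<And>n. f n \<subseteq> f (Suc n)"
  shows "\<exists>n. inconsistent L (f n)"
proof -
  obtain X where X: "set_mset X \<subseteq> (\<Union>n. f n)" "derivable L (GL L) X"
    using assms(1) by (auto simp: inconsistent_def)
  have mono: "m \<le> n \<Longrightarrow> f m \<subseteq> f n" for m n using lift_Suc_mono_le[of f] assms(2) by blast
  (* A derivable hypersequent is finite, so it is contained in one stage. *)
  have "finite F \<Longrightarrow> F \<subseteq> (\<Union>n. f n) \<Longrightarrow> \<exists>n. F \<subseteq> f n" for F
  proof (induction rule: finite_induct)
    case (insert S F)
    then obtain m n where "S \<in> f m" "F \<subseteq> f n" by auto
    then have "insert S F \<subseteq> f (max m n)" using mono[of m "max m n"] mono[of n "max m n"] by auto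
    then show ?case by blast
  qed simp
  from this[OF finite_set_mset X(1)] show ?thesis
    using X(2) unfolding inconsistent_def by blast
qed

text \<open>A Lindenbaum construction along an enumeration of all pairs of a sequent and a formula. Witnesses
are added together with the sequents, so each stage differs from \<open>H0\<close> by finitely many sequents only,
and a fresh variable remains. It suffices to visit each pair once: a sequent that belongs to the union is
consistent with every stage, hence is added at the latest when its turn comes.\<close>

lemma exists_max_consistent:
  assumes L: "countable_language L" and H0: "\<not> inconsistent L H0" "\<forall>S\<in>H0. lsequent L S"
    and inf: "infinite (- (\<Union>S\<in>H0. fvars_sequent S))"
  shows "\<exists>H. H0 \<subseteq> H \<and> max_consistent L H \<and>
    (\<forall>\<Gamma> x A \<Delta>. (\<Gamma>, add_mset (All x A) \<Delta>) \<in> H \<longrightarrow> (\<exists>a. (\<Gamma>, add_mset (inst x (FVar a) A) \<Delta>) \<in> H)) \<and>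
    (\<forall>\<Gamma> x A \<Delta>. (add_mset (Ex x A) \<Gamma>, \<Delta>) \<in> H \<longrightarrow> (\<exists>a. (add_mset (inst x (FVar a) A) \<Gamma>, \<Delta>) \<in> H))"
proof -
  let ?K = "{S. lsequent L S} \<times> {A. formula L A}"
  have K: "countable ?K" using L by (intro countable_SIGMA countable_lsequents countable_formulas)
  have "(({#}, {#}), Bot) \<in> ?K" by simp
  then have "?K \<noteq> {}" by blast
  define e where "e = from_nat_into ?K"
  have e: "range e = ?K" unfolding e_def using \<open>?K \<noteq> {}\<close> K by (rule range_from_nat_into)
  define good where "good X \<longleftrightarrow> H0 \<subseteq> X \<and> finite (X - H0) \<and> (\<forall>S\<in>X. lsequent L S) \<and> \<not> inconsistent L X" for X
  define decides where "decides n X Y \<longleftrightarrow> X \<subseteq> Y \<and>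
      (\<not> inconsistent L (insert (fst (e n)) X) \<longrightarrow> fst (e n) \<in> Y) \<and>
      (fst (e n) \<in> Y \<longrightarrow> witnesses (e n) \<noteq> {} \<longrightarrow> witnesses (e n) \<inter> Y \<noteq> {})" for n X Y
  have good_insert: "good (insert S X)"
    if "good X" "lsequent L S" "\<not> inconsistent L (insert S X)" for S X
    using that unfolding good_def by (auto simp: insert_Diff_if)
  have step: "\<exists>Y. good Y \<and> decides n X Y" if X: "good X" for n X
  proof -
    let ?S = "fst (e n)"
    have lS: "lsequent L ?S" using e by (metis mem_Sigma_iff mem_Collect_eq prod.collapse rangeI)
    define Y where "Y = (if inconsistent L (insert ?S X) then X else insert ?S X)"
    have Y: "good Y" using X good_insert lS by (auto simp: Y_def)
    have "X \<subseteq> Y" by (auto simp: Y_def)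
    show ?thesis
    proof (cases "?S \<in> Y \<and> witnesses (e n) \<noteq> {}")
      case False
      then have "decides n X Y" by (auto simp: decides_def Y_def)
      with Y show ?thesis by blast
    next
      case True
      have "finite (\<Union>S\<in>Y - H0. fvars_sequent S)"
        using Y by (auto simp: good_def finite_fvars_sequent)
      then have "infinite (- (\<Union>S\<in>H0. fvars_sequent S) - (\<Union>S\<in>Y - H0. fvars_sequent S))"
        using inf Diff_infinite_finite by blast
      moreover have "- (\<Union>S\<in>H0. fvars_sequent S) - (\<Union>S\<in>Y - H0. fvars_sequent S)
          \<subseteq> - (\<Union>S\<in>Y. fvars_sequent S)"
        by auto
      ultimately have "infinite (- (\<Union>S\<in>Y. fvars_sequent S))" using infinite_super by blast
      then obtain P where P: "P \<in> witnesses (e n)" "lsequent L P" "\<not> inconsistent L (insert P Y)"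
        using witness_consistent[of L Y ?S "snd (e n)"] Y True by (auto simp: good_def)
      have "decides n X (insert P Y)"
        using P(1) True \<open>X \<subseteq> Y\<close> by (auto simp: decides_def)
      then show ?thesis using good_insert[OF Y P(2,3)] by blast
    qed
  qed
  have "good H0" using H0 by (simp add: good_def)
  then obtain f where f: "good (f n)" "decides n (f n) (f (Suc n))" "H0 \<subseteq> f n" for n
  proof -
    obtain f where "\<forall>n. good (f n) \<and> decides n (f n) (f (Suc n))"
      using dependent_nat_choice[of "\<lambda>n. good" decides] step \<open>good H0\<close> by blast
    then show ?thesis by (intro that[of f]) (auto simp: good_def)
  qed
  let ?H = "\<Union>n. f n"
  have con: "\<not> inconsistent L ?H"
    using inconsistent_chain[of L f] f by (auto simp: good_def decides_def)
  have "max_consistent L ?H"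
    unfolding max_consistent_def
  proof (intro conjI allI impI con)
    show "\<forall>S\<in>?H. lsequent L S" using f(1) by (auto simp: good_def)
    fix S assume S: "lsequent L S" "\<not> inconsistent L (insert S ?H)"
    (* Any formula serves as the second component here; Bot asks for no witness. *)
    then have "(S, Bot) \<in> range e" by (simp add: e)
    then obtain n where "e n = (S, Bot)" by auto
    moreover have "\<not> inconsistent L (insert S (f n))"
    proof
      assume "inconsistent L (insert S (f n))"
      then have "inconsistent L (insert S ?H)" by (rule inconsistent_mono) auto
      with S(2) show False by contradiction
    qed
    ultimately show "S \<in> ?H" using f(2)[of n] by (auto simp: decides_def)
  qed
  have wit: "witnesses (S, F) \<inter> ?H \<noteq> {}"
    if "S \<in> ?H" "formula L F" "witnesses (S, F) \<noteq> {}" for S F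
  proof -
    have "lsequent L S" using that(1) f(1) by (auto simp: good_def)
    then have "(S, F) \<in> range e" using that(2) by (simp add: e)
    then obtain n where n: "e n = (S, F)" by auto
    have "\<not> inconsistent L (insert S (f n))"
    proof
      assume "inconsistent L (insert S (f n))"
      then have "inconsistent L ?H" by (rule inconsistent_mono) (use that(1) in auto)
      with con show False by contradiction
    qed
    then have "witnesses (S, F) \<inter> f (Suc n) \<noteq> {}"
      using f(2)[of n] n that(3) by (auto simp: decides_def)
    then show ?thesis by blast
  qed
  have lH: "lsequent L S" if "S \<in> ?H" for S using that f(1) by (auto simp: good_def)
  have w1: "\<exists>a. (\<Gamma>, add_mset (inst x (FVar a) A) \<Delta>) \<in> ?H" if "(\<Gamma>, add_mset (All x A) \<Delta>) \<in> ?H" for \<Gamma> x A \<Delta>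
  proof -
    have "witnesses ((\<Gamma>, add_mset (All x A) \<Delta>), All x A) \<inter> ?H \<noteq> {}"
      using lH[OF that] by (intro wit[OF that]) auto
    then show ?thesis by auto
  qed
  have w2: "\<exists>a. (add_mset (inst x (FVar a) A) \<Gamma>, \<Delta>) \<in> ?H" if "(add_mset (Ex x A) \<Gamma>, \<Delta>) \<in> ?H" for \<Gamma> x A \<Delta>
  proof -
    have "witnesses ((add_mset (Ex x A) \<Gamma>, \<Delta>), Ex x A) \<inter> ?H \<noteq> {}"
      using lH[OF that] by (intro wit[OF that]) auto
    then show ?thesis by auto
  qed
  have sub: "H0 \<subseteq> ?H" using f(3) by blast
  show ?thesis
    by (intro exI[of _ ?H] conjI allI impI) (rule sub, rule \<open>max_consistent L ?H\<close>, erule w1, erule w2)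
qed

section \<open>Real values for a consistent set of sequents\<close>

text \<open>A combinatorial form of derivability of a single sequent from the axioms, (IW) and (M): formulas on
the right are matched with equal formulas on the left, and the remaining ones with occurrences of \<open>\<bottom>\<close>.
If all formulas are atomic, this says that the sequent is true for all values in \<open>[0,1]\<close> of the atoms
other than \<open>\<bottom>\<close>. As a condition on counts it is additive, and invariant under adding the same formulas on
both sides, which would be hard to see on derivations.\<close>

definition basic :: "('f, 'p) sequent \<Rightarrow> bool" where
  "basic S \<longleftrightarrow>
     size {#A \<in># snd S - fst S. A \<noteq> Bot#} + count (snd S) Bot \<le> count (fst S) Bot"

lemma basic_plus:
  assumes "basic S" "basic S'"
  shows "basic (S + S')"
proof -
  let ?nb = "filter_mset (\<lambda>A. A \<noteq> Bot)"
  have "?nb (snd (S + S') - fst (S + S')) \<subseteq># ?nb (snd S - fst S) + ?nb (snd S' - fst S')"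
    by (auto simp: subseteq_mset_def)
  from size_mset_mono[OF this] show ?thesis
    using assms by (simp add: basic_def)
qed

lemma basic_cancel: "basic (S + (\<Theta>, \<Theta>)) \<longleftrightarrow> basic S"
  by (simp add: basic_def)

lemma basic_mono:
  assumes "basic (\<Gamma>, \<Delta>)" "\<Gamma> \<subseteq># \<Gamma>'" "\<Delta>' \<subseteq># \<Delta>"
  shows "basic (\<Gamma>', \<Delta>')"
proof -
  have "\<Delta>' - \<Gamma>' \<subseteq># \<Delta> - \<Gamma>"
    using assms(2,3) unfolding subseteq_mset_def count_diff
    by (meson diff_le_mono diff_le_mono2 le_trans)
  then have "size {#A \<in># \<Delta>' - \<Gamma>'. A \<noteq> Bot#} \<le> size {#A \<in># \<Delta> - \<Gamma>. A \<noteq> Bot#}"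
    by (intro size_mset_mono multiset_filter_mono)
  moreover have "count \<Delta>' Bot \<le> count \<Delta> Bot" "count \<Gamma> Bot \<le> count \<Gamma>' Bot"
    using assms(2,3) by (auto simp: subseteq_mset_def)
  ultimately show ?thesis using assms(1) by (simp add: basic_def)
qed

lemma basic_derivable:
  "basic (\<Gamma>, \<Delta>) \<Longrightarrow> lsequent L (\<Gamma>, \<Delta>) \<Longrightarrow> derivable L (GL L) {#(\<Gamma>, \<Delta>)#}"
proof (induction \<Delta> arbitrary: \<Gamma>)
  case empty
  then show ?case
    by (induction \<Gamma>) (auto simp: basic_def intro: GL.axiom_empty GL.int_weakening)
next
  case (add A \<Delta>)
  show ?case
  proof (cases "A \<in># \<Gamma>")
    case True
    then obtain \<Gamma>' where \<Gamma>: "\<Gamma> = add_mset A \<Gamma>'" by (metis mset_add)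
    have "basic ((\<Gamma>', \<Delta>) + ({#A#}, {#A#}))" using add.prems(1) \<Gamma> by simp
    then have "derivable L (GL L) {#(\<Gamma>', \<Delta>)#}"
      using add \<Gamma> unfolding basic_cancel by simp
    from GL.mix[OF this GL.axiom_id[of L A]] show ?thesis using add.prems(2) \<Gamma> by simp
  next
    case False
    have nA: "A \<noteq> Bot" using False add.prems(1) by (auto simp: basic_def not_in_iff)
    have eq: "add_mset A \<Delta> - \<Gamma> = add_mset A (\<Delta> - \<Gamma>)" using False by simp
    with add.prems(1) nA have "Bot \<in># \<Gamma>" by (auto simp: basic_def intro!: count_inI)
    then obtain \<Gamma>' where \<Gamma>: "\<Gamma> = add_mset Bot \<Gamma>'" by (metis mset_add)
    have "size {#A \<in># \<Delta> - \<Gamma>'. A \<noteq> Bot#} = size {#A \<in># \<Delta> - \<Gamma>. A \<noteq> Bot#}"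
      unfolding \<Gamma> by (intro arg_cong[where f = size] multiset_eqI) auto
    moreover have "size {#B \<in># add_mset A \<Delta> - \<Gamma>. B \<noteq> Bot#} = Suc (size {#B \<in># \<Delta> - \<Gamma>. B \<noteq> Bot#})"
      unfolding eq using nA by simp
    moreover have "count (add_mset A \<Delta>) Bot = count \<Delta> Bot" "count \<Gamma> Bot = Suc (count \<Gamma>' Bot)"
      using nA \<Gamma> by simp_all
    ultimately have "basic (\<Gamma>', \<Delta>)"
      using add.prems(1) unfolding basic_def fst_conv snd_conv by linarith
    then have "derivable L (GL L) {#(\<Gamma>', \<Delta>)#}" using add \<Gamma> by simp
    from GL.mix[OF this GL.axiom_bot[of L A]] show ?thesis using add.prems(2) \<Gamma> by simp
  qed
qed

definition smul :: "nat \<Rightarrow> ('f, 'p) sequent \<Rightarrow> ('f, 'p) sequent" where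
  "smul k S = (repeat_mset k (fst S), repeat_mset k (snd S))"

lemma smul_simp [simp]: "smul k (\<Gamma>, \<Delta>) = (repeat_mset k \<Gamma>, repeat_mset k \<Delta>)"
  by (simp add: smul_def)

lemma smul_0 [simp]: "smul 0 S = 0"
  by (simp add: smul_def zero_prod_def)

lemma smul_Suc: "smul (Suc k) S = S + smul k S"
  by (cases S) (simp add: plus_prod_def)

lemma smul_add: "smul k (S + S') = smul k S + smul k S'"
  by (simp add: smul_def plus_prod_def)

lemma smul_smul: "smul j (smul k S) = smul (j * k) S"
  by (auto simp: smul_def multiset_eq_iff)

lemma sum_replicate_sequent: "\<Sum>\<^sub># (replicate_mset k S) = smul k S"
  by (induction k) (simp_all add: smul_Suc)

lemma smul_sum: "smul k (\<Sum>\<^sub># Y) = \<Sum>\<^sub># (repeat_mset k Y)"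
  by (induction k) (simp_all add: smul_Suc)

lemma basic_zero: "basic 0"
  by (simp add: basic_def zero_prod_def)

lemma basic_smul: "basic S \<Longrightarrow> basic (smul k S)"
  by (induction k) (simp_all add: smul_Suc basic_plus basic_zero)

lemma replicate_plus_filter: "replicate_mset (count Y u) u + {#S \<in># Y. S \<noteq> u#} = Y"
  by (rule multiset_eqI) simp

lemma in_repeat_mset: "x \<in># repeat_mset n A \<Longrightarrow> x \<in># A"
  by (induction n) auto

lemma replicate_mset_add: "replicate_mset (m + n) A = replicate_mset m A + replicate_mset n A"
  by (induction m) auto

text \<open>Sequents are added componentwise and thought of as formal differences \<open>\<Delta> - \<Gamma>\<close>; those in a positive
set are meant to be greater than 0.\<close>

definition positive :: "('f, 'p) sequent set \<Rightarrow> bool" where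
  "positive P \<longleftrightarrow> (\<forall>Y. Y \<noteq> {#} \<longrightarrow> set_mset Y \<subseteq> P \<longrightarrow> \<not> basic (\<Sum>\<^sub># Y))"

text \<open>The sequent \<open>\<Rightarrow> \<bottom>\<close> is included to ensure that \<open>\<bottom>\<close> is strictly positive and can serve as the
unit of measurement. It does no harm: deleting \<open>\<bottom>\<close> on the right preserves basic sequents, and a basic
sum of sequents of \<open>H\<close> would yield, by (S), a derivable hypersequent over \<open>H\<close>.\<close>

lemma positive_with_unit:
  fixes H :: "('f, 'p) sequent set"
  assumes H: "\<not> inconsistent L H" "\<forall>S\<in>H. lsequent L S"
  shows "positive (insert ({#}, {#Bot#}) H)"
  unfolding positive_def
proof (intro allI impI notI)
  let ?u = "({#}, {#Bot#})"
  fix Y assume Y: "Y \<noteq> {#}" "set_mset Y \<subseteq> insert ?u H" and b: "basic (\<Sum>\<^sub># Y)"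
  define Y' where "Y' = {#S \<in># Y. S \<noteq> ?u#}"
  have Y_eq: "Y = replicate_mset (count Y ?u) ?u + Y'"
    by (simp add: replicate_plus_filter Y'_def)
  then have "\<Sum>\<^sub># Y = smul (count Y ?u) ?u + \<Sum>\<^sub># Y'"
    by (metis sum_replicate_sequent sum_mset.union)
  then have eq: "\<Sum>\<^sub># Y = (fst (\<Sum>\<^sub># Y'), snd (\<Sum>\<^sub># Y') + replicate_mset (count Y ?u) Bot)"
    by (simp add: plus_prod_def repeat_mset_replicate_mset)
  have b': "basic (fst (\<Sum>\<^sub># Y'), snd (\<Sum>\<^sub># Y'))"
    using b unfolding eq by (rule basic_mono) auto
  show False
  proof (cases "Y' = {#}")
    case True
    then have "count Y ?u > 0"
      using Y(1) Y_eq by (metis add_0_right neq0_conv replicate_mset_0)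
    moreover have "basic ({#} :: ('f, 'p) semiformula multiset, replicate_mset (count Y ?u) Bot)"
      using b True unfolding eq by (simp add: zero_prod_def)
    then have "count Y ?u \<le> 0" by (simp only: basic_def fst_conv snd_conv) simp
    ultimately show False by linarith
  next
    case False
    have sub: "set_mset Y' \<subseteq> H" using Y(2) by (auto simp: Y'_def)
    have "set_mset Z \<subseteq> H \<Longrightarrow> lsequent L (\<Sum>\<^sub># Z)" for Z
      using H(2) by (induction Z) (auto simp: zero_prod_def)
    then have "derivable L (GL L) {#\<Sum>\<^sub># Y'#}"
      using basic_derivable[OF b', of L] sub by simp
    from GL.split_sum[OF this False] sub H(1) show False
      by (auto simp: inconsistent_def)
  qed
qed

lemma maximal_positive:
  assumes "positive P0"
  shows "\<exists>P. P0 \<subseteq> P \<and> positive P \<and> (\<forall>S. positive (insert S P) \<longrightarrow> S \<in> P)"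
proof -
  let ?A = "{P. P0 \<subseteq> P \<and> positive P}"
  have "\<exists>M\<in>?A. \<forall>X\<in>?A. M \<subseteq> X \<longrightarrow> X = M"
  proof (rule subset_Zorn_nonempty)
    show "?A \<noteq> {}" using assms by auto
    fix C assume C: "C \<noteq> {}" "subset.chain ?A C"
    have "positive (\<Union>C)"
      unfolding positive_def
    proof (intro allI impI)
      fix Y assume Y: "Y \<noteq> {#}" "set_mset Y \<subseteq> \<Union>C"
      obtain P where "P \<in> C" "set_mset Y \<subseteq> P"
        using finite_subset_Union_chain[OF finite_set_mset Y(2) C] by blast
      then show "\<not> basic (\<Sum>\<^sub># Y)" using Y(1) C(2) by (auto simp: positive_def subset.chain_def)
    qed
    moreover have "P0 \<subseteq> \<Union>C"
    proof -
      obtain P where "P \<in> C" using C(1) by blast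
      moreover from this have "P0 \<subseteq> P" using C(2) by (auto simp: subset.chain_def)
      ultimately show ?thesis by blast
    qed
    ultimately show "\<Union>C \<in> ?A" by simp
  qed
  then obtain P where "P0 \<subseteq> P" "positive P" and max: "\<And>X. P0 \<subseteq> X \<Longrightarrow> positive X \<Longrightarrow> P \<subseteq> X \<Longrightarrow> X = P"
    by auto
  moreover have "S \<in> P" if "positive (insert S P)" for S
    using max[of "insert S P"] \<open>P0 \<subseteq> P\<close> that by blast
  ultimately show ?thesis by blast
qed

text \<open>A maximal positive set is the strictly positive part of a total preorder: both the set and its
complement turn out to be closed under addition.\<close>

locale positive_cone =
  fixes P :: "('f, 'p) sequent set"
  assumes pos: "positive P"
    and max: "positive (insert S P) \<Longrightarrow> S \<in> P"
    and unit: "({#}, {#Bot#}) \<in> P"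
begin

text \<open>By maximality, a sequent is left out only for a concrete reason: some positive multiple of it,
together with elements of \<open>P\<close>, has a basic sum.\<close>

lemma not_in_iff: "S \<notin> P \<longleftrightarrow> (\<exists>k>0. \<exists>Y. set_mset Y \<subseteq> P \<and> basic (smul k S + \<Sum>\<^sub># Y))"
proof
  assume "S \<notin> P"
  then have "\<not> positive (insert S P)" using max by blast
  then obtain Y where Y: "Y \<noteq> {#}" "set_mset Y \<subseteq> insert S P" "basic (\<Sum>\<^sub># Y)"
    unfolding positive_def by blast
  let ?Y = "{#R \<in># Y. R \<noteq> S#}"
  have "Y = replicate_mset (count Y S) S + ?Y" by (simp add: replicate_plus_filter)
  then have "\<Sum>\<^sub># Y = smul (count Y S) S + \<Sum>\<^sub># ?Y" by (metis sum_replicate_sequent sum_mset.union)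
  moreover have "count Y S > 0"
  proof (rule ccontr)
    assume "\<not> ?thesis"
    then have "S \<notin># Y" by (simp add: Multiset.not_in_iff)
    then have "set_mset Y \<subseteq> P" using Y(2) by auto
    then show False using pos Y by (auto simp: positive_def)
  qed
  moreover have "set_mset ?Y \<subseteq> P" using Y(2) by auto
  ultimately show "\<exists>k>0. \<exists>Y. set_mset Y \<subseteq> P \<and> basic (smul k S + \<Sum>\<^sub># Y)"
    using Y(3) by metis
next
  assume "\<exists>k>0. \<exists>Y. set_mset Y \<subseteq> P \<and> basic (smul k S + \<Sum>\<^sub># Y)"
  then obtain k Y where kY: "k > 0" "set_mset Y \<subseteq> P" "basic (smul k S + \<Sum>\<^sub># Y)" by blast
  show "S \<notin> P"
  proof
    assume "S \<in> P"
    with kY(1,2) have "replicate_mset k S + Y \<noteq> {#}" "set_mset (replicate_mset k S + Y) \<subseteq> P"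
      by (auto simp: set_mset_replicate_mset_subset)
    with pos kY(3) show False
      unfolding positive_def by (metis sum_mset.union sum_replicate_sequent)
  qed
qed

lemma basic_not_in: "basic S \<Longrightarrow> S \<notin> P"
  unfolding not_in_iff by (intro exI[of _ 1] conjI exI[of _ "{#}"]) (auto simp: smul_def)

lemma plus_not_in:
  assumes "S \<notin> P" "S' \<notin> P"
  shows "S + S' \<notin> P"
proof -
  obtain k Y where k: "k > 0" "set_mset Y \<subseteq> P" "basic (smul k S + \<Sum>\<^sub># Y)"
    using assms(1) unfolding not_in_iff by blast
  obtain k' Y' where k': "k' > 0" "set_mset Y' \<subseteq> P" "basic (smul k' S' + \<Sum>\<^sub># Y')"
    using assms(2) unfolding not_in_iff by blast
  (* The multiplicities of the two sequents are brought to the common value k * k'. *)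
  let ?Y = "repeat_mset k' Y + repeat_mset k Y'"
  have "smul k' (smul k S + \<Sum>\<^sub># Y) + smul k (smul k' S' + \<Sum>\<^sub># Y')
      = smul (k * k') (S + S') + \<Sum>\<^sub># ?Y"
    by (simp add: smul_add smul_smul smul_sum mult.commute add_ac)
  moreover have "basic (smul k' (smul k S + \<Sum>\<^sub># Y) + smul k (smul k' S' + \<Sum>\<^sub># Y'))"
    by (rule basic_plus[OF basic_smul[OF k(3)] basic_smul[OF k'(3)]])
  ultimately have "basic (smul (k * k') (S + S') + \<Sum>\<^sub># ?Y)" by simp
  moreover have "set_mset ?Y \<subseteq> P" using k(2) k'(2) by (auto dest: in_repeat_mset)
  moreover have "k * k' > 0" using k(1) k'(1) by simp
  ultimately show ?thesis unfolding not_in_iff by blast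
qed

lemma plus_in:
  assumes "S \<in> P" "S' \<in> P"
  shows "S + S' \<in> P"
proof (rule ccontr)
  assume "S + S' \<notin> P"
  then obtain k Y where k: "k > 0" "set_mset Y \<subseteq> P" "basic (smul k (S + S') + \<Sum>\<^sub># Y)"
    unfolding not_in_iff by blast
  have "smul k (S + S') + \<Sum>\<^sub># Y = smul k S + \<Sum>\<^sub># (replicate_mset k S' + Y)"
    by (simp add: smul_add sum_replicate_sequent add_ac)
  moreover have "set_mset (replicate_mset k S' + Y) \<subseteq> P"
    using k(2) assms(2) by (auto simp: set_mset_replicate_mset_subset)
  ultimately have "S \<notin> P" using k(1,3) unfolding not_in_iff by metis
  then show False using assms(1) by simp
qed

lemma cancel: "S + (\<Theta>, \<Theta>) \<in> P \<longleftrightarrow> S \<in> P"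
proof -
  have "smul k (S + (\<Theta>, \<Theta>)) + \<Sum>\<^sub># Y = (smul k S + \<Sum>\<^sub># Y) + (repeat_mset k \<Theta>, repeat_mset k \<Theta>)"
    for k Y
    by (simp add: smul_add add_ac)
  then have eq: "basic (smul k (S + (\<Theta>, \<Theta>)) + \<Sum>\<^sub># Y) \<longleftrightarrow> basic (smul k S + \<Sum>\<^sub># Y)" for k Y
    by (simp only: basic_cancel)
  show ?thesis using not_in_iff[of S] not_in_iff[of "S + (\<Theta>, \<Theta>)"] unfolding eq by blast
qed

lemma mono:
  assumes "(\<Gamma>', \<Delta>') \<in> P" "\<Gamma> \<subseteq># \<Gamma>'" "\<Delta>' \<subseteq># \<Delta>"
  shows "(\<Gamma>, \<Delta>) \<in> P"
proof (rule ccontr)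
  assume "(\<Gamma>, \<Delta>) \<notin> P"
  moreover have "basic (\<Gamma>' - \<Gamma>, {#})" by (simp add: basic_def)
  then have "(\<Gamma>' - \<Gamma>, {#}) \<notin> P" by (rule basic_not_in)
  moreover have "basic (\<Delta> - \<Delta>', \<Delta> - \<Delta>')" by (simp add: basic_def)
  ultimately have "(\<Gamma>', \<Delta>) \<notin> P"
    using plus_not_in[of "(\<Gamma>, \<Delta>)" "(\<Gamma>' - \<Gamma>, {#})"] assms(2) by simp
  then have "(\<Gamma>' + (\<Delta> - \<Delta>'), \<Delta>) \<notin> P"
    using plus_not_in[of "(\<Gamma>', \<Delta>)" "(\<Delta> - \<Delta>', {#})"] basic_not_in[of "(\<Delta> - \<Delta>', {#})"]
    by (simp add: basic_def)
  moreover have "(\<Gamma>' + (\<Delta> - \<Delta>'), \<Delta>) = (\<Gamma>', \<Delta>') + (\<Delta> - \<Delta>', \<Delta> - \<Delta>')"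
    using assms(3) by simp
  ultimately show False using assms(1) by (metis cancel)
qed

lemma smul_in: "k > 0 \<Longrightarrow> smul k S \<in> P \<longleftrightarrow> S \<in> P"
proof -
  have "smul (Suc k) S \<in> P \<longleftrightarrow> S \<in> P" for k
  proof (induction k)
    case (Suc k)
    then show ?case using plus_in[of S "smul (Suc k) S"] plus_not_in[of S "smul (Suc k) S"]
      by (metis smul_Suc)
  qed (simp add: smul_Suc)
  then show "k > 0 \<Longrightarrow> smul k S \<in> P \<longleftrightarrow> S \<in> P" by (metis gr0_conv_Suc)
qed

text \<open>The fractions \<open>j/k\<close> with \<open>j \<bottom> < k A\<close> in the order given by \<open>P\<close>. The number 0 is put in because the
set would be empty for a formula that is not positive.\<close>

definition value_fractions :: "('f, 'p) semiformula \<Rightarrow> real set" where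
  "value_fractions A =
     insert 0 {real j / real k |j k. k > 0 \<and> (replicate_mset j Bot, replicate_mset k A) \<in> P}"

definition val :: "('f, 'p) semiformula \<Rightarrow> real" where
  "val A = Sup (value_fractions A)"

text \<open>If \<open>k \<le> j\<close>, every formula on the right can be matched with an occurrence of \<open>\<bottom>\<close>.\<close>

lemma fraction_less:
  assumes "(replicate_mset j Bot, replicate_mset k A) \<in> P"
  shows "j < k"
proof (rule ccontr)
  assume "\<not> ?thesis"
  moreover have "size {#B \<in># replicate_mset k A - replicate_mset j Bot. B \<noteq> Bot#} \<le> k"
    by (metis diff_subset_eq_self multiset_filter_subset size_mset_mono size_replicate_mset subset_mset.order_trans)
  moreover have none: "{#B \<in># replicate_mset k Bot. B \<noteq> Bot#} = ({#} :: ('f, 'p) semiformula multiset)"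
    by (induction k) auto
  ultimately have "basic (replicate_mset j Bot, replicate_mset k A)"
    by (cases "A = Bot") (auto simp: basic_def none)
  with assms basic_not_in show False by blast
qed

lemma value_fractions_le_1: "r \<in> value_fractions A \<Longrightarrow> r \<le> 1"
  using fraction_less by (fastforce simp: value_fractions_def)

lemma bdd_value_fractions: "bdd_above (value_fractions A)"
  using value_fractions_le_1 by (rule bdd_aboveI)

lemma val_nonneg: "0 \<le> val A"
  unfolding val_def by (rule cSup_upper[OF _ bdd_value_fractions]) (simp add: value_fractions_def)

lemma val_le_1: "val A \<le> 1"
  unfolding val_def by (rule cSup_least) (auto simp: value_fractions_le_1, simp add: value_fractions_def)

lemma fraction_le_val:
  "k > 0 \<Longrightarrow> (replicate_mset j Bot, replicate_mset k A) \<in> P \<Longrightarrow> real j / real k \<le> val A"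
  unfolding val_def by (rule cSup_upper[OF _ bdd_value_fractions]) (auto simp: value_fractions_def)

text \<open>The set of fractions below the cut is downward closed, also with respect to different
denominators, because membership in \<open>P\<close> is invariant under positive multiples.\<close>

lemma in_if_less_val:
  assumes k: "k > 0" and less: "real j < real k * val A"
  shows "(replicate_mset j Bot, replicate_mset k A) \<in> P"
proof (rule ccontr)
  assume out: "\<not> ?thesis"
  have "real j / real k < val A" using assms by (simp add: field_simps)
  then obtain r where r: "r \<in> value_fractions A" "real j / real k < r"
    unfolding val_def using less_cSup_iff[OF _ bdd_value_fractions] by (auto simp: value_fractions_def)
  moreover have "0 \<le> real j / real k" by simp
  ultimately have "r \<noteq> 0" by linarith
  then obtain j' k' where jk': "r = real j' / real k'" "k' > 0"
      "(replicate_mset j' Bot, replicate_mset k' A) \<in> P"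
    using r(1) by (auto simp: value_fractions_def)
  have "real j * real k' < real j' * real k"
    using r(2) jk'(1,2) k by (simp add: field_simps)
  then have le: "j * k' \<le> j' * k" by (metis less_imp_le of_nat_less_iff of_nat_mult)
  have "smul k (replicate_mset j' Bot, replicate_mset k' A) \<in> P"
    using jk' k by (simp only: smul_in)
  then have "smul k' (replicate_mset j Bot, replicate_mset k A) \<in> P"
    unfolding smul_simp by (rule mono) (use le in \<open>auto simp: subseteq_mset_def mult.commute\<close>)
  then show False using out jk'(2) by (simp only: smul_in)
qed

text \<open>The sequents \<open>k \<bottom> \<Rightarrow> (k+1) \<bottom>\<close> differ from the unit by formulas common to both sides.\<close>

lemma val_Bot: "val Bot = 1"
proof (rule antisym[OF val_le_1])
  have bound: "1 - inverse (real (Suc k)) \<le> val Bot" for k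
  proof -
    have "({#}, {#Bot#}) + (replicate_mset k Bot, replicate_mset k Bot) \<in> P"
      using unit by (simp only: cancel)
    then have "(replicate_mset k Bot, replicate_mset (Suc k) Bot) \<in> P" by simp
    from fraction_le_val[OF _ this] show ?thesis by (simp add: field_simps)
  qed
  show "1 \<le> val Bot"
  proof (rule ccontr)
    assume "\<not> 1 \<le> val Bot"
    then obtain k where "inverse (real (Suc k)) < 1 - val Bot"
      using reals_Archimedean[of "1 - val Bot"] by auto
    with bound[of k] show False by linarith
  qed
qed

abbreviation mval :: "('f, 'p) semiformula multiset \<Rightarrow> real" where
  "mval \<Gamma> \<equiv> (\<Sum>A\<in>#\<Gamma>. val A)"

text \<open>For each \<open>A\<close> in \<open>\<Gamma>\<close>, with \<open>j\<close> the ceiling of \<open>k v\<close> for the value \<open>v\<close> of \<open>A\<close>, the order gives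
\<open>(j-1) \<bottom> < k A\<close>, that is, \<open>j \<bottom> < k A + \<bottom>\<close>. The second form also makes sense for \<open>j = 0\<close>, where it
follows from \<open>0 < \<bottom>\<close>. The sequent \<open>S\<close> is there to make the statement true for empty \<open>\<Gamma>\<close>.\<close>

lemma add_lower_bound:
  assumes k: "k > 0" and S: "S \<in> P"
  shows "\<exists>J. S + (replicate_mset J Bot, repeat_mset k \<Gamma> + replicate_mset (size \<Gamma>) Bot) \<in> P
    \<and> real k * mval \<Gamma> \<le> real J"
proof (induction \<Gamma>)
  case empty
  have "S + (replicate_mset 0 Bot, repeat_mset k {#} + replicate_mset (size {#}) Bot) \<in> P"
    using S by (simp add: zero_prod_def[symmetric])
  then show ?case by (metis image_mset_empty mult_zero_right of_nat_0_le_iff sum_mset.empty)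
next
  case (add A \<Gamma>)
  then obtain J where J: "S + (replicate_mset J Bot, repeat_mset k \<Gamma> + replicate_mset (size \<Gamma>) Bot) \<in> P"
      "real k * mval \<Gamma> \<le> real J"
    by blast
  define j where "j = nat \<lceil>real k * val A\<rceil>"
  have j: "real k * val A \<le> real j" by (simp add: j_def real_nat_ceiling_ge)
  have "(replicate_mset j Bot, replicate_mset k A + {#Bot#}) \<in> P"
  proof (cases j)
    case 0
    then show ?thesis using mono[OF unit, of "{#}" "replicate_mset k A + {#Bot#}"] by simp
  next
    case (Suc i)
    then have "real i < real k * val A" by (simp add: j_def) linarith
    from in_if_less_val[OF k this]
    have "(replicate_mset i Bot, replicate_mset k A) + ({#Bot#}, {#Bot#}) \<in> P" by (simp only: cancel)
    then show ?thesis using Suc by simp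
  qed
  from plus_in[OF J(1) this]
  have "S + (replicate_mset (J + j) Bot, repeat_mset k (add_mset A \<Gamma>) + replicate_mset (size (add_mset A \<Gamma>)) Bot) \<in> P"
    by (simp add: plus_prod_def replicate_mset_add add_ac repeat_mset_replicate_mset)
  moreover have "real k * mval (add_mset A \<Gamma>) \<le> real (J + j)"
    using J(2) j by (simp add: algebra_simps)
  ultimately show ?case by blast
qed

lemma upper_bound:
  assumes k: "k > 0"
  shows "\<exists>J. (replicate_mset J Bot, repeat_mset k \<Delta>) \<notin> P \<and> real J \<le> real k * mval \<Delta> + size \<Delta>"
proof (induction \<Delta>)
  case empty
  show ?case
    using basic_not_in[OF basic_zero] by (intro exI[of _ 0]) (simp add: zero_prod_def)
next
  case (add A \<Delta>)
  then obtain J where J: "(replicate_mset J Bot, repeat_mset k \<Delta>) \<notin> P"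
      "real J \<le> real k * mval \<Delta> + size \<Delta>"
    by blast
  (* one more than the floor, so that j / k is strictly above the value *)
  define j where "j = Suc (nat \<lfloor>real k * val A\<rfloor>)"
  have "0 \<le> real k * val A" using val_nonneg by simp
  then have j: "real k * val A < real j" "real j \<le> real k * val A + 1"
    unfolding j_def by linarith+
  have "(replicate_mset j Bot, replicate_mset k A) \<notin> P"
    using fraction_le_val[OF k, of j A] j(1) k by (auto simp: field_simps)
  from plus_not_in[OF J(1) this]
  have "(replicate_mset (J + j) Bot, repeat_mset k (add_mset A \<Delta>)) \<notin> P"
    by (simp add: plus_prod_def replicate_mset_add repeat_mset_replicate_mset add_ac)
  moreover have "real (J + j) \<le> real k * mval (add_mset A \<Delta>) + size (add_mset A \<Delta>)"
    using J(2) j(2) by (simp add: algebra_simps)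
  ultimately show ?case by blast
qed

text \<open>Otherwise choose \<open>k\<close> so large that the gap between the values, multiplied by \<open>k\<close>, exceeds the
rounding errors, which are at most 1 per formula. Then \<open>k \<Gamma> < k \<Delta>\<close> and the bounds for \<open>k \<Gamma>\<close> from below and for
\<open>k \<Delta>\<close> from above by multiples of \<open>\<bottom>\<close> contradict each other.\<close>

lemma mval_le:
  assumes S: "(\<Gamma>, \<Delta>) \<in> P"
  shows "mval \<Gamma> \<le> mval \<Delta>"
proof (rule ccontr)
  assume "\<not> ?thesis"
  then have "mval \<Gamma> - mval \<Delta> > 0" by simp
  from reals_Archimedean3[OF this, rule_format, of "real (size \<Gamma> + size \<Delta>)"]
  obtain k where k: "real (size \<Gamma> + size \<Delta>) < real k * (mval \<Gamma> - mval \<Delta>)" by blast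
  then have k0: "k > 0" by (cases k) auto
  have "smul k (\<Gamma>, \<Delta>) \<in> P" using S k0 by (simp only: smul_in)
  from add_lower_bound[OF k0 this, of \<Gamma>] obtain J
    where J: "smul k (\<Gamma>, \<Delta>) + (replicate_mset J Bot, repeat_mset k \<Gamma> + replicate_mset (size \<Gamma>) Bot) \<in> P"
      "real k * mval \<Gamma> \<le> real J" by blast
  obtain J' where J': "(replicate_mset J' Bot, repeat_mset k \<Delta>) \<notin> P"
      "real J' \<le> real k * mval \<Delta> + size \<Delta>"
    using upper_bound[OF k0] by blast
  have "smul k (\<Gamma>, \<Delta>) + (replicate_mset J Bot, repeat_mset k \<Gamma> + replicate_mset (size \<Gamma>) Bot)
      = (replicate_mset J Bot, repeat_mset k \<Delta> + replicate_mset (size \<Gamma>) Bot)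
        + (repeat_mset k \<Gamma>, repeat_mset k \<Gamma>)"
    by (simp add: plus_prod_def add_ac)
  with J(1) have in_P: "(replicate_mset J Bot, repeat_mset k \<Delta> + replicate_mset (size \<Gamma>) Bot) \<in> P"
    by (simp only: cancel)
  have "J < J' + size \<Gamma>"
  proof (rule ccontr)
    assume "\<not> ?thesis"
    then have "replicate_mset (J' + size \<Gamma>) Bot \<subseteq># replicate_mset J Bot"
      by (simp add: subseteq_mset_def)
    from mono[OF in_P this]
    have "(replicate_mset (J' + size \<Gamma>) Bot, repeat_mset k \<Delta> + replicate_mset (size \<Gamma>) Bot) \<in> P"
      by simp
    moreover have "(replicate_mset (J' + size \<Gamma>) Bot, repeat_mset k \<Delta> + replicate_mset (size \<Gamma>) Bot)
        = (replicate_mset J' Bot, repeat_mset k \<Delta>)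
          + (replicate_mset (size \<Gamma>) Bot, replicate_mset (size \<Gamma>) Bot)"
      by (simp add: plus_prod_def replicate_mset_add)
    ultimately show False using J'(1) by (metis cancel)
  qed
  then have "real J \<le> real J' + real (size \<Gamma>)" by linarith
  with k J(2) J'(2) show False by (simp add: algebra_simps)
qed

end

text \<open>All formulas get values here, but these need not respect the connectives; only the values of the
atomic formulas will enter the term model.\<close>

lemma exists_valuation:
  assumes "\<not> inconsistent L H" "\<forall>S\<in>H. lsequent L S"
  shows "\<exists>v :: ('f, 'p) semiformula \<Rightarrow> real. (\<forall>A. 0 \<le> v A \<and> v A \<le> 1) \<and> v Bot = 1 \<and>
    (\<forall>(\<Gamma>, \<Delta>)\<in>H. (\<Sum>A\<in>#\<Gamma>. v A) \<le> (\<Sum>A\<in>#\<Delta>. v A))"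
proof -
  obtain P where P: "insert ({#}, {#Bot#}) H \<subseteq> P" "positive P" "\<forall>S. positive (insert S P) \<longrightarrow> S \<in> P"
    using maximal_positive[OF positive_with_unit[OF assms]] by blast
  interpret positive_cone P
    using P by unfold_locales auto
  show ?thesis
    using P(1) mval_le val_Bot val_nonneg val_le_1 by (intro exI[of _ val]) auto
qed

section \<open>The term model\<close>

lemma exists_term_coding:
  assumes "countable_language L" "infinite (UNIV :: 'm set)"
  shows "\<exists>g :: 'f semiterm \<Rightarrow> 'm. inj_on g {t. lterm L t}"
proof -
  obtain h :: "nat \<Rightarrow> 'm" where h: "inj h"
    using infinite_countable_subset[OF assms(2)] by blast
  show ?thesis
    by (intro exI[of _ "h \<circ> to_nat_on {t. lterm L t}"] comp_inj_on inj_on_to_nat_on countable_lterms[OF assms(1)]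
        inj_on_subset[OF h] subset_UNIV)
qed

text \<open>The universe consists of the terms of the language, coded in the given type by \<open>g\<close>.\<close>

locale term_model =
  fixes L :: "('f, 'p) language" and H :: "('f, 'p) sequent set"
    and v :: "('f, 'p) semiformula \<Rightarrow> real" and g :: "'f semiterm \<Rightarrow> 'm"
  assumes H: "max_consistent L H"
    and all_witness: "(\<Gamma>, add_mset (All x A) \<Delta>) \<in> H \<Longrightarrow> \<exists>a. (\<Gamma>, add_mset (inst x (FVar a) A) \<Delta>) \<in> H"
    and ex_witness: "(add_mset (Ex x A) \<Gamma>, \<Delta>) \<in> H \<Longrightarrow> \<exists>a. (add_mset (inst x (FVar a) A) \<Gamma>, \<Delta>) \<in> H"
    and v_bounds: "0 \<le> v A \<and> v A \<le> 1"
    and v_Bot: "v Bot = 1"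
    and v_mono: "(\<Gamma>, \<Delta>) \<in> H \<Longrightarrow> (\<Sum>A\<in>#\<Gamma>. v A) \<le> (\<Sum>A\<in>#\<Delta>. v A)"
    and g: "inj_on g {t. lterm L t}"
begin

abbreviation decode :: "'m \<Rightarrow> 'f semiterm" where
  "decode \<equiv> inv_into {t. lterm L t} g"

text \<open>The bound variables get an arbitrary element of the universe.\<close>

definition I :: "('f, 'p, 'm) interp" where
  "I = \<lparr>univ = g ` {t. lterm L t},
        fun_val = \<lambda>f ms. g (Fn f (map decode ms)),
        pred_val = \<lambda>p ms. v (Pred p (map decode ms)),
        fassign = \<lambda>a. g (FVar a),
        bassign = \<lambda>x. g (FVar 0)\<rparr>"

lemma decode_g: "lterm L t \<Longrightarrow> decode (g t) = t"
  using g by (simp add: inv_into_f_f)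

lemma lterm_decode: "m \<in> g ` {t. lterm L t} \<Longrightarrow> lterm L (decode m)"
  using inv_into_into[of m g "{t. lterm L t}"] by simp

lemma interpretation_I: "interpretation01 L I"
proof -
  have var: "lterm L (FVar a)" for a by (rule lterm.intros)
  have fn: "lterm L (Fn f (map decode ms))"
    if "f \<in> funs L" "length ms = fun_arity L f" "set ms \<subseteq> g ` {t. lterm L t}" for f ms
    using that lterm_decode by (intro lterm.intros(2)) auto
  show ?thesis
    unfolding interpretation01_def I_def using v_bounds var fn by auto
qed

lemma term_val_I: "lterm L t \<Longrightarrow> term_val I t = g t"
proof (induction rule: lterm.induct)
  case (2 f ts)
  then have "map decode (map (term_val I) ts) = ts"
    by (auto simp: decode_g intro!: map_idI)
  then show ?case by (simp add: I_def)
qed (simp add: I_def)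

lemma truth_val_I_atomic:
  assumes "formula L A" "connectives A = 0"
  shows "truth_val I A = v A"
proof (cases A)
  case (Pred p ts)
  then have "lterm L t" if "t \<in> set ts" for t
    using assms(1) that by (simp add: formula_iff_wf_formula lterm_iff_wf_term)
  then have "map decode (map (term_val I) ts) = ts"
    by (auto simp: decode_g term_val_I intro!: map_idI)
  then show ?thesis using Pred by (simp add: I_def)
qed (use assms v_Bot in auto)

lemma truth_val_I_instance:
  assumes "m \<in> univ I"
  obtains t where "lterm L t"
    "truth_val (I\<lparr>bassign := (bassign I)(x := m)\<rparr>) A = truth_val I (inst x t A)"
proof -
  obtain t where t: "lterm L t" "m = g t" using assms by (auto simp: I_def)
  then show thesis
    by (intro that[of t]) (simp_all add: truth_val_inst lterm_bvars term_val_I)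
qed

lemma quantifier_bounds_I:
  assumes "\<And>t. lterm L t \<Longrightarrow> r \<le> truth_val I (inst x t A) \<and> truth_val I (inst x t A) \<le> s"
  shows "truth_val I (All x A) \<le> s" "r \<le> truth_val I (Ex x A)"
proof -
  have "univ I \<noteq> {}" using interpretation_I by (simp add: interpretation01_def)
  moreover have "r \<le> truth_val (I\<lparr>bassign := (bassign I)(x := m)\<rparr>) A
      \<and> truth_val (I\<lparr>bassign := (bassign I)(x := m)\<rparr>) A \<le> s" if "m \<in> univ I" for m
    using truth_val_I_instance[OF that, of x A] assms by metis
  ultimately show "truth_val I (All x A) \<le> s" "r \<le> truth_val I (Ex x A)"
    by (auto intro!: cSUP_least cINF_greatest)
qed

abbreviation weight :: "('f, 'p) semiformula multiset \<Rightarrow> nat" where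
  "weight \<Gamma> \<equiv> (\<Sum>A\<in>#\<Gamma>. connectives A)"

text \<open>Each logical rule, read upwards from a sequent of \<open>H\<close>, leads to sequents of \<open>H\<close> with fewer
connectives. Quantifiers whose rule takes arbitrary terms give the inequality for all elements of the
universe, as these are values of terms, and it passes to the supremum or infimum because it is not
strict; for the other ones a single witness suffices.\<close>

lemma truth_lemma: "(\<Gamma>, \<Delta>) \<in> H \<Longrightarrow> mset_val I \<Gamma> \<le> mset_val I \<Delta>"
proof (induction "weight \<Gamma> + weight \<Delta>" arbitrary: \<Gamma> \<Delta> rule: less_induct)
  case less
  have lS: "\<forall>A\<in>#\<Gamma>. formula L A" "\<forall>A\<in>#\<Delta>. formula L A"
    using max_consistent_lsequent[OF H less.prems] by (auto simp: lsequent_def)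
  consider (left) A \<Gamma>' where "\<Gamma> = add_mset A \<Gamma>'" "connectives A \<noteq> 0"
    | (right) A \<Delta>' where "\<Delta> = add_mset A \<Delta>'" "connectives A \<noteq> 0"
    | (atomic) "\<forall>A\<in>#\<Gamma>. connectives A = 0" "\<forall>A\<in>#\<Delta>. connectives A = 0"
    by (metis mset_add)
  then show ?case
  proof cases
    case left
    have fA: "formula L A" using lS left by simp
    show ?thesis
    proof (cases A)
      case (Imp B C)
      have "(\<Gamma>', \<Delta>) \<in> H" "(add_mset C \<Gamma>', add_mset B \<Delta>) \<in> H"
        using max_consistent_imp_left[OF H] less.prems left Imp by auto
      then have "mset_val I \<Gamma>' \<le> mset_val I \<Delta>"
        "mset_val I (add_mset C \<Gamma>') \<le> mset_val I (add_mset B \<Delta>)"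
        using left Imp by (auto intro!: less.hyps simp del: mset_val_simps)
      then show ?thesis using left Imp by simp
    next
      case (All x B)
      have "truth_val I (inst x t B) \<le> mset_val I \<Delta> - mset_val I \<Gamma>'" if t: "lterm L t" for t
      proof -
        have "(add_mset (inst x t B) \<Gamma>', \<Delta>) \<in> H"
          using max_consistent_all_left[OF H _ t] less.prems left All by auto
        then have "mset_val I (add_mset (inst x t B) \<Gamma>') \<le> mset_val I \<Delta>"
          using left All by (intro less.hyps) auto
        then show ?thesis by simp
      qed
      moreover have "0 \<le> truth_val I (inst x t B)" if "lterm L t" for t
        using truth_val_formula[OF interpretation_I] formula_inst(1)[OF _ that] fA All by blast
      ultimately have "truth_val I (All x B) \<le> mset_val I \<Delta> - mset_val I \<Gamma>'"
        by (intro quantifier_bounds_I(1)[of 0]) auto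
      then show ?thesis using left All by (simp del: truth_val.simps)
    next
      case (Ex x B)
      obtain a where "(add_mset (inst x (FVar a) B) \<Gamma>', \<Delta>) \<in> H"
        using ex_witness less.prems left Ex by blast
      then have "mset_val I (add_mset (inst x (FVar a) B) \<Gamma>') \<le> mset_val I \<Delta>"
        using left Ex by (intro less.hyps) auto
      moreover have "truth_val I (Ex x B) \<le> truth_val I (inst x (FVar a) B)"
        using truth_val_quantifier_instance(2)[OF interpretation_I] fA Ex lterm.intros(1) by blast
      ultimately show ?thesis using left Ex by (simp del: truth_val.simps)
    qed (use left in auto)
  next
    case right
    have fA: "formula L A" using lS right by simp
    show ?thesis
    proof (cases A)
      case (Imp B C)
      have "(\<Gamma>, \<Delta>') \<in> H \<or> (add_mset B \<Gamma>, add_mset C \<Delta>') \<in> H"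
        using max_consistent_imp_right[OF H] less.prems right Imp by auto
      then have "mset_val I \<Gamma> \<le> mset_val I \<Delta>'
          \<or> mset_val I (add_mset B \<Gamma>) \<le> mset_val I (add_mset C \<Delta>')"
      proof (elim disj_forward)
        assume "(\<Gamma>, \<Delta>') \<in> H"
        then show "mset_val I \<Gamma> \<le> mset_val I \<Delta>'"
          using right Imp by (intro less.hyps) auto
      next
        assume "(add_mset B \<Gamma>, add_mset C \<Delta>') \<in> H"
        then show "mset_val I (add_mset B \<Gamma>) \<le> mset_val I (add_mset C \<Delta>')"
          using right Imp by (intro less.hyps) auto
      qed
      then show ?thesis using right Imp by (auto simp: max_def)
    next
      case (Ex x B)
      have "mset_val I \<Gamma> - mset_val I \<Delta>' \<le> truth_val I (inst x t B)" if t: "lterm L t" for t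
      proof -
        have "(\<Gamma>, add_mset (inst x t B) \<Delta>') \<in> H"
          using max_consistent_ex_right[OF H _ t] less.prems right Ex by auto
        then have "mset_val I \<Gamma> \<le> mset_val I (add_mset (inst x t B) \<Delta>')"
          using right Ex by (intro less.hyps) auto
        then show ?thesis by simp
      qed
      moreover have "truth_val I (inst x t B) \<le> 1" if "lterm L t" for t
        using truth_val_formula[OF interpretation_I] formula_inst(2)[OF _ that] fA Ex by blast
      ultimately have "mset_val I \<Gamma> - mset_val I \<Delta>' \<le> truth_val I (Ex x B)"
        by (intro quantifier_bounds_I(2)[of _ _ _ 1]) auto
      then show ?thesis using right Ex by (simp del: truth_val.simps)
    next
      case (All x B)
      obtain a where "(\<Gamma>, add_mset (inst x (FVar a) B) \<Delta>') \<in> H"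
        using all_witness less.prems right All by blast
      then have "mset_val I \<Gamma> \<le> mset_val I (add_mset (inst x (FVar a) B) \<Delta>')"
        using right All by (intro less.hyps) auto
      moreover have "truth_val I (inst x (FVar a) B) \<le> truth_val I (All x B)"
        using truth_val_quantifier_instance(1)[OF interpretation_I] fA All lterm.intros(1) by blast
      ultimately show ?thesis using right All by (simp del: truth_val.simps)
    qed (use right in auto)
  next
    case atomic
    have "mset_val I \<Gamma> = (\<Sum>A\<in>#\<Gamma>. v A)" "mset_val I \<Delta> = (\<Sum>A\<in>#\<Delta>. v A)"
      unfolding mset_val_def using atomic lS
      by (auto intro!: arg_cong[where f = sum_mset] image_mset_cong truth_val_I_atomic)
    then show ?thesis using v_mono[OF less.prems] by simp
  qed
qed

end

text \<open>The value 0 is allowed, so this is not yet a refutation of the sequents in \<open>H0\<close>. For sequents of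
the form \<open>\<bottom>, n\<Gamma> \<Rightarrow> n\<Delta>\<close> it is one of \<open>\<Gamma> \<Rightarrow> \<Delta>\<close>.\<close>

lemma consistent_has_model:
  fixes H0 :: "('f, 'p) sequent set"
  assumes L: "countable_language L" and m: "infinite (UNIV :: 'm set)"
    and H0: "\<not> inconsistent L H0" "\<forall>S\<in>H0. lsequent L S" "infinite (- (\<Union>S\<in>H0. fvars_sequent S))"
  shows "\<exists>I :: ('f, 'p, 'm) interp. interpretation01 L I \<and> (\<forall>S\<in>H0. 0 \<le> sequent_val I S)"
proof -
  obtain H where sub: "H0 \<subseteq> H" and H: "max_consistent L H"
    and all_w: "\<And>\<Gamma> x A \<Delta>. (\<Gamma>, add_mset (All x A) \<Delta>) \<in> H \<Longrightarrow> \<exists>a. (\<Gamma>, add_mset (inst x (FVar a) A) \<Delta>) \<in> H"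
    and ex_w: "\<And>\<Gamma> x A \<Delta>. (add_mset (Ex x A) \<Gamma>, \<Delta>) \<in> H \<Longrightarrow> \<exists>a. (add_mset (inst x (FVar a) A) \<Gamma>, \<Delta>) \<in> H"
    using exists_max_consistent[OF L H0] by metis
  obtain v :: "('f, 'p) semiformula \<Rightarrow> real"
    where v: "\<forall>A. 0 \<le> v A \<and> v A \<le> 1" "v Bot = 1"
      "\<forall>(\<Gamma>, \<Delta>)\<in>H. (\<Sum>A\<in>#\<Gamma>. v A) \<le> (\<Sum>A\<in>#\<Delta>. v A)"
    using exists_valuation[of L H] H unfolding max_consistent_def by metis
  obtain g :: "'f semiterm \<Rightarrow> 'm" where g: "inj_on g {t. lterm L t}"
    using exists_term_coding[OF L m] by blast
  interpret term_model L H v g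
    using H all_w ex_w v g by unfold_locales auto
  have "0 \<le> sequent_val I S" if "S \<in> H0" for S
    using truth_lemma[of "fst S" "snd S"] sub that by (auto simp: sequent_val_def)
  then show ?thesis using interpretation_I by blast
qed

section \<open>Approximations and the equivalence\<close>

lemma sequent_val_approx: "sequent_val I (approx_sequent n S) = real n * sequent_val I S - 1"
  by (cases S) (simp add: approx_sequent_def algebra_simps)

lemma lsequent_approx: "lsequent L S \<Longrightarrow> lsequent L (approx_sequent n S)"
  by (cases S) (auto simp: approx_sequent_def lsequent_def dest: in_repeat_mset)

lemma lhypersequent_approx: "lhypersequent L G \<Longrightarrow> lhypersequent L (approx n G)"
  by (auto simp: approx_def lhypersequent_def lsequent_approx)

text \<open>A hypersequent that is not true has finitely many positive values; for large \<open>n\<close> all of them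
exceed \<open>1/n\<close>.\<close>

lemma true_in_approx_limit:
  assumes "\<And>n. n \<ge> 2 \<Longrightarrow> true_in I (approx n G)"
  shows "true_in I G"
proof (rule ccontr)
  assume "\<not> ?thesis"
  then have "\<forall>S\<in>#G. 0 < sequent_val I S" by (auto simp: true_in_iff not_le)
  then have "\<exists>k. \<forall>n\<ge>k. \<forall>S\<in>#G. 1 < real n * sequent_val I S"
  proof (induction G)
    case (add S G)
    then obtain k where k: "\<forall>n\<ge>k. \<forall>S\<in>#G. 1 < real n * sequent_val I S" by auto
    have pos: "0 < sequent_val I S" using add.prems by simp
    from reals_Archimedean3[OF this] obtain j where j: "1 < real j * sequent_val I S" by blast
    have "1 < real n * sequent_val I S" if "n \<ge> j" for n
    proof -
      have "real j * sequent_val I S \<le> real n * sequent_val I S"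
        using that pos by (intro mult_right_mono) auto
      with j show ?thesis by linarith
    qed
    with k have "\<forall>n\<ge>max j k. \<forall>R\<in>#add_mset S G. 1 < real n * sequent_val I R" by simp
    then show ?case by blast
  qed simp
  then obtain k where k: "\<forall>S\<in>#G. 1 < real (max k 2) * sequent_val I S" by (meson max.cobounded1)
  have "true_in I (approx (max k 2) G)" by (rule assms) simp
  then obtain S where "S \<in># G" "real (max k 2) * sequent_val I S - 1 \<le> 0"
    unfolding true_in_iff approx_def by (auto simp only: sequent_val_approx set_image_mset)
  with k show False by force
qed

abbreviation theory_sequent :: "nat \<Rightarrow> nat \<times> ('f, 'p) semiformula \<Rightarrow> ('f, 'p) sequent" where
  "theory_sequent n \<equiv> (\<lambda>(m, C). approx_sequent n (replicate_mset m C, {#Bot#}))"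

lemma lsequent_theory_sequent:
  assumes "ltheory L T" "snd mC \<in> T"
  shows "lsequent L (theory_sequent n mC)"
proof -
  obtain m C where mC: "mC = (m, C)" by (cases mC)
  then have "lsequent L (replicate_mset m C, {#Bot#})"
    using assms by (auto simp: lsequent_def ltheory_def split: if_splits)
  then show ?thesis using mC by (simp add: lsequent_approx)
qed

lemma sequent_val_theory_sequent:
  "sequent_val I (theory_sequent n (m, C)) = real n * (1 - real m * truth_val I C) - 1"
  by (simp add: sequent_val_approx)

text \<open>For \<open>n = 1\<close> the argument breaks down: the sequents that mention \<open>T\<close> then have the value 0 in a
model of \<open>T\<close> and are true themselves.\<close>

lemma approximations_sound:
  fixes I :: "('f, 'p, 'm) interp"
  assumes I: "model01 L T I" and n: "n \<ge> 2" and mCs: "\<forall>(m, C)\<in>set mCs. m > 0 \<and> C \<in> T"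
    and D: "derivable L (GL L) (mset (map (theory_sequent n) mCs) + approx n G)"
  shows "true_in I (approx n G)"
proof -
  have "derivable L (GL_sCut L) (mset (map (theory_sequent n) mCs) + approx n G)"
    using D by (rule derivable_from_calculus_mono) (simp add: GL_sCut_def)
  then have "true_in I (mset (map (theory_sequent n) mCs) + approx n G)"
    by (rule soundness) (use I in \<open>simp add: model01_def\<close>)
  moreover have "0 < sequent_val I (theory_sequent n (m, C))" if "(m, C) \<in> set mCs" for m C
  proof -
    have "C \<in> T" using mCs that by auto
    then have "truth_val I C \<le> 0" using I by (auto simp: model01_def of_formula_def)
    then have "real m * truth_val I C \<le> 0" by (simp add: mult_nonneg_nonpos)
    then have "real n * 1 \<le> real n * (1 - real m * truth_val I C)" by (intro mult_left_mono) auto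
    moreover have "2 \<le> real n" using n by simp
    ultimately show ?thesis unfolding sequent_val_theory_sequent by linarith
  qed
  ultimately show ?thesis
    by (fastforce simp: true_in_iff)
qed

text \<open>Components of the given hypersequent that belong to the approximation of \<open>G\<close> are absorbed, and each
of the others is one of the sequents that mention \<open>T\<close>.\<close>

lemma derivable_if_inconsistent:
  assumes T: "ltheory L T" and G: "lhypersequent L G"
    and inc: "inconsistent L
      (theory_sequent n ` {(m, C). m > 0 \<and> C \<in> T} \<union> set_mset (approx n G))"
  shows "\<exists>mCs. (\<forall>(m, C)\<in>set mCs. m > 0 \<and> C \<in> T) \<and>
    derivable L (GL L) (mset (map (theory_sequent n) mCs) + approx n G)"
proof -
  let ?K = "{(m, C). m > (0::nat) \<and> C \<in> T}"
  obtain X where X: "set_mset X \<subseteq> theory_sequent n ` ?K \<union> set_mset (approx n G)"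
    "derivable L (GL L) X"
    using inc by (auto simp: inconsistent_def)
  obtain xs where xs: "mset xs = {#S \<in># X. S \<notin># approx n G#}" using ex_mset by blast
  have "\<forall>S\<in>set xs. \<exists>mC\<in>?K. theory_sequent n mC = S"
  proof
    fix S assume "S \<in> set xs"
    then have "S \<in># mset xs" by simp
    then have "S \<in># X" "S \<notin># approx n G" unfolding xs by simp_all
    then show "\<exists>mC\<in>?K. theory_sequent n mC = S" using X(1) by blast
  qed
  then obtain c where c: "\<forall>S\<in>set xs. c S \<in> ?K \<and> theory_sequent n (c S) = S" by metis
  let ?mCs = "map c xs"
  have K: "\<forall>(m, C)\<in>set ?mCs. m > 0 \<and> C \<in> T" using c by auto
  have "map (theory_sequent n) ?mCs = xs" using c by (auto intro!: map_idI)
  then have mset: "mset (map (theory_sequent n) ?mCs) = {#S \<in># X. S \<notin># approx n G#}" using xs by metis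
  have "derivable L (GL L) (mset (map (theory_sequent n) ?mCs) + approx n G)"
  proof (rule GL.derivable_support[OF X(2)])
    show "lhypersequent L (mset (map (theory_sequent n) ?mCs) + approx n G)"
      using GL.lhyp[OF X(2)] lhypersequent_approx[OF G] unfolding mset
      by (auto simp: lhypersequent_def)
  qed (auto simp only: mset set_mset_union set_mset_filter)
  with K show ?thesis by blast
qed

text \<open>The theory may contain all free variables, so they are first moved to the even numbers, leaving
the odd ones as witnesses. A model for the renamed sequents becomes one for the original sequents by
composing its assignment with the renaming.\<close>

lemma entails_imp_approximations:
  fixes G :: "('f, 'p) hypersequent"
  assumes L: "countable_language L" and T: "ltheory L T" and G: "lhypersequent L G"
    and m: "infinite (UNIV :: 'm set)" and n: "n > 0" and ent: "entails01 TYPE('m) L T G"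
  shows "\<exists>mCs. (\<forall>(m, C)\<in>set mCs. m > 0 \<and> C \<in> T) \<and>
    derivable L (GL L) (mset (map (theory_sequent n) mCs) + approx n G)"
proof (rule derivable_if_inconsistent[OF T G], rule ccontr)
  let ?K = "{(m, C). m > (0::nat) \<and> C \<in> T}"
  let ?B = "theory_sequent n ` ?K \<union> set_mset (approx n G)"
  let ?\<rho> = "\<lambda>a::nat. 2 * a"
  let ?H = "ren_sequent ?\<rho> ` ?B"
  assume con: "\<not> inconsistent L ?B"
  have lB: "lsequent L S" if "S \<in> ?B" for S
    using that lsequent_theory_sequent[OF T] lhypersequent_approx[OF G, of n]
    by (auto simp: lhypersequent_def)
  have con_H: "\<not> inconsistent L ?H"
  proof
    assume "inconsistent L ?H"
    then obtain X where X: "set_mset X \<subseteq> ?H" "derivable L (GL L) X" by (auto simp: inconsistent_def)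
    let ?X = "image_mset (ren_sequent (\<lambda>a. a div 2)) X"
    have "derivable L (GL L) ?X"
      by (rule derivable_ren[OF X(2)]) (simp add: fvars_theory_def)
    moreover have "set_mset ?X \<subseteq> ?B"
    proof -
      have "ren_sequent (\<lambda>a. a div 2) (ren_sequent ?\<rho> S) = S" for S :: "('f, 'p) sequent"
        by (simp add: ren_sequent_ren_sequent ren_sequent_id)
      then have "ren_sequent (\<lambda>a. a div 2) ` ?H = ?B" by (simp add: image_image)
      moreover have "set_mset ?X \<subseteq> ren_sequent (\<lambda>a. a div 2) ` ?H"
        using X(1) by (simp only: set_image_mset image_mono)
      ultimately show ?thesis by simp
    qed
    ultimately show False using con unfolding inconsistent_def by blast
  qed
  have lH: "\<forall>S\<in>?H. lsequent L S" using lB lsequent_ren by blast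
  have fresh: "infinite (- (\<Union>S\<in>?H. fvars_sequent S))"
  proof -
    have "range (\<lambda>a::nat. 2 * a + 1) \<subseteq> - (\<Union>S\<in>?H. fvars_sequent S)"
      by (auto simp: fvars_ren_sequent) presburger+
    moreover have "infinite (range (\<lambda>a::nat. 2 * a + 1))"
      by (intro range_inj_infinite) (simp add: inj_def)
    ultimately show ?thesis by (rule infinite_super)
  qed
  obtain I0 :: "('f, 'p, 'm) interp"
    where I0: "interpretation01 L I0" "\<forall>S\<in>?H. 0 \<le> sequent_val I0 S"
    using consistent_has_model[OF L m con_H lH fresh] by (elim exE conjE) (rule that)
  define I where "I = I0\<lparr>fassign := fassign I0 \<circ> ?\<rho>\<rparr>"
  have I: "interpretation01 L I"
    using I0(1) unfolding I_def by (rule interpretation01_fassign) (use I0(1) in \<open>simp add: interpretation01_def\<close>)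
  have ren_val: "sequent_val I0 (ren_sequent ?\<rho> S) = sequent_val I S" for S :: "('f, 'p) sequent"
    by (cases S) (simp add: mset_val_def truth_val_ren I_def multiset.map_comp comp_def)
  have val: "0 \<le> sequent_val I S" if "S \<in> ?B" for S
    using bspec[OF I0(2) imageI[OF that]] by (simp only: ren_val)
  have "truth_val I C \<le> 0" if C: "C \<in> T" for C
  proof (rule ccontr)
    assume "\<not> ?thesis"
    then have pos: "0 < truth_val I C" by simp
    from reals_Archimedean3[OF this] obtain m where m: "1 < real m * truth_val I C" by blast
    then have "m > 0" by (cases m) auto
    with C have "theory_sequent n (m, C) \<in> ?B" by blast
    from val[OF this] have "1 \<le> real n * (1 - real m * truth_val I C)"
      unfolding sequent_val_theory_sequent by simp
    moreover have "real n * (1 - real m * truth_val I C) \<le> 0"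
      using m by (intro mult_nonneg_nonpos) auto
    ultimately show False by simp
  qed
  then have "model01 L T I" using I by (simp add: model01_def of_formula_def)
  then have "true_in I G" using ent by (auto simp: entails01_def)
  then obtain S where S: "S \<in># G" "sequent_val I S \<le> 0" by (auto simp: true_in_iff)
  then have "0 \<le> sequent_val I (approx_sequent n S)" by (intro val) (auto simp: approx_def)
  then have "1 \<le> real n * sequent_val I S" unfolding sequent_val_approx by simp
  moreover have "real n * sequent_val I S \<le> 0" using S(2) by (simp add: mult_nonneg_nonpos)
  ultimately show False by simp
qed

lemma cut_theory_sequents:
  assumes T: "ltheory L T" and n: "n \<ge> 2" and G: "X \<noteq> {#}"
    and mCs: "\<forall>(m, C)\<in>set mCs. C \<in> T"
    and D: "derivable_from L (GL_sCut L) T (mset (map (theory_sequent n) mCs) + X)"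
  shows "derivable_from L (GL_sCut L) T X"
  using mCs D
proof (induction mCs)
  case (Cons mC mCs)
  obtain m C where [simp]: "mC = (m, C)" by (cases mC)
  have "derivable_from L (GL_sCut L) T (mset (map (theory_sequent n) mCs) + X)"
    by (rule cut_theory_formula[of C T L n _ m]) (use Cons.prems T n G in auto)
  then show ?case using Cons by simp
qed simp

theorem theorem3p14:
  fixes L :: "('f, 'p) language"
    and T :: "('f, 'p) semiformula set"
    and G :: "('f, 'p) hypersequent"
  assumes "countable_language L"
    and "ltheory L T"
    and "lhypersequent L G"
    and "infinite (UNIV :: 'm set)"
  shows
    "(entails01 TYPE('m) L T G \<longleftrightarrow>
       (\<forall>n::nat. n > 0 \<longrightarrow>
          (\<exists>mCs :: (nat \<times> ('f, 'p) semiformula) list.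
             (\<forall>(m, C)\<in>set mCs. m > 0 \<and> C \<in> T) \<and>
             derivable L (GL L)
               (mset (map (\<lambda>(m, C). approx_sequent n (replicate_mset m C, {#Bot#})) mCs)
                + approx n G))))
     \<and> ((\<forall>n::nat. n > 0 \<longrightarrow> derivable_from L (GL_sCut L) T (approx n G)) \<longrightarrow>
          entails01 TYPE('m) L T G)
     \<and> (G \<noteq> {#} \<and> infinite (- fvars_theory T) \<longrightarrow>
          entails01 TYPE('m) L T G \<longrightarrow>
          (\<forall>n::nat. n > 0 \<longrightarrow> derivable_from L (GL_sCut L) T (approx n G)))"
    (is "(?a \<longleftrightarrow> ?b) \<and> (?c \<longrightarrow> ?a) \<and> (?fresh \<longrightarrow> ?a \<longrightarrow> ?c)")
proof (intro conjI impI)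
  have a_b: ?b if ?a
    using entails_imp_approximations[OF assms _ that] by blast
  have b_a: ?a if b: ?b
    unfolding entails01_def
  proof (intro allI impI)
    fix I :: "('f, 'p, 'm) interp" assume I: "model01 L T I"
    show "true_in I G"
    proof (rule true_in_approx_limit)
      fix n :: nat assume n: "n \<ge> 2"
      then obtain mCs where "\<forall>(m, C)\<in>set mCs. m > 0 \<and> C \<in> T"
        "derivable L (GL L) (mset (map (theory_sequent n) mCs) + approx n G)"
        using b[rule_format, of n] by auto
      then show "true_in I (approx n G)" using approximations_sound[OF I n] by blast
    qed
  qed
  show "?a \<longleftrightarrow> ?b" using a_b b_a by (rule iffI)
  show ?a if c: ?c
    unfolding entails01_def
  proof (intro allI impI)
    fix I :: "('f, 'p, 'm) interp" assume I: "model01 L T I"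
    show "true_in I G"
    proof (rule true_in_approx_limit)
      fix n :: nat assume "n \<ge> 2"
      then have "derivable_from L (GL_sCut L) T (approx n G)" using c by simp
      then show "true_in I (approx n G)" using I by (rule soundness)
    qed
  qed
  show ?c if fresh: ?fresh and ?a
  proof (intro allI impI)
    have ge2: "derivable_from L (GL_sCut L) T (approx n G)" if n: "n \<ge> 2" for n
    proof -
      obtain mCs where mCs: "\<forall>(m, C)\<in>set mCs. m > 0 \<and> C \<in> T"
        and D: "derivable L (GL L) (mset (map (theory_sequent n) mCs) + approx n G)"
        using a_b[OF \<open>?a\<close>, rule_format, of n] n by auto
      have "derivable_from L (GL L) T (mset (map (theory_sequent n) mCs) + approx n G)"
        using derivable_ren[OF D, of T "\<lambda>a. a"] fresh
        by (simp add: ren_sequent_id multiset.map_ident_strong)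
      then have "derivable_from L (GL_sCut L) T (mset (map (theory_sequent n) mCs) + approx n G)"
        by (rule derivable_from_calculus_mono) (simp add: GL_sCut_def)
      then show ?thesis
        by (rule cut_theory_sequents[OF assms(2) n, rotated 2]) (use fresh mCs in \<open>auto simp: approx_def\<close>)
    qed
    fix n :: nat assume "n > 0"
    show "derivable_from L (GL_sCut L) T (approx n G)"
    proof (cases "n = 1")
      case True
      then show ?thesis using GLcut.approx_1_of_2[OF ge2[of 2]] by simp
    qed (use ge2[of n] \<open>n > 0\<close> in auto)
  qed
qed

end
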